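(* Let $\Delta_n$ be a uniform flag triangulation of the boundary $\partial P_n$ of the root polytope in the lex class, i.e. pairs of arrows of types $THTH$ and $HTHT$ both do not nest, and pairs of types $THHT$ and $HTTH$ both do not cross. Then for $0\le i\le k$, the number of $(k-1)$-dimensional faces of $\Delta_n$ consisting of $i$ forward arrows and $k-i$ backward arrows is $$f(\Delta_n,i,k-i)=\frac{f_{k-1}(\Delta_n)}{k+1}=\frac{1}{k+1}\binom{n+k}{k}\binom{n}{k},$$ which in particular is independent of $i$.
   Context: $P_n$ is the convex hull of $e_j-e_i$ ($i\ne j$) in $\mathbb{R}^{n+1}$. An arrow $(i,j)$, $i\ne j\in\{1,\dots,n+1\}$, with tail $i$ and head $j$, is identified with $e_j-e_i$; forward if $i<j$, backward if $i>j$; $V_n$ is the set of arrows. A uniform flag triangulation of $\partial P_n$ is a flag simplicial complex on $V_n$ representing a triangulation of $\partial P_n$ (no new vertices) in which whether a pair $\{(i_1,j_1),(i_2,j_2)\}$ is an edge depends only on the equalities and inequalities among $i_1,i_2,j_1,j_2$. For two arrows with four distinct endpoints $p_1<\dots<p_4$ the type is the $T/H$ word of tails/heads at $p_1,\dots,p_4$; the pair nests if it joins $\{p_1,p_4\},\{p_2,p_3\}$, crosses if it joins $\{p_1,p_3\},\{p_2,p_4\}$; "does not nest"/"does not cross" means such pairs are not edges. $f(\Delta_n,i,j)$ is the number of faces with $i$ forward and $j$ backward arrows, and $f_{k-1}(\Delta_n)$ is the number of $(k-1)$-dimensional faces. *)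

theory Defs
  imports "HOL-Analysis.Analysis"
begin

text \<open>
  The coordinates of the ambient space of dimension \<open>n + 1\<close> are indexed by a finite linearly
  ordered type \<open>'m\<close> with \<open>n + 1\<close> elements, which plays the role of \<open>{1, ..., n + 1}\<close>.
  An arrow with tail \<open>i\<close> and head \<open>j\<close> is the pair \<open>(i, j)\<close>.
\<close>

type_synonym 'm arrow = "'m \<times> 'm"

abbreviation tail :: "'m arrow \<Rightarrow> 'm" where
  "tail \<equiv> fst"

abbreviation head :: "'m arrow \<Rightarrow> 'm" where
  "head \<equiv> snd"

definition arrows :: "'m arrow set" where
  "arrows = {a. tail a \<noteq> head a}"

definition forward :: "'m::linorder arrow \<Rightarrow> bool" where
  "forward a \<longleftrightarrow> tail a < head a"

definition backward :: "'m::linorder arrow \<Rightarrow> bool" where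
  "backward a \<longleftrightarrow> tail a > head a"

definition arrow_vec :: "'m::finite arrow \<Rightarrow> real ^ 'm" where
  "arrow_vec a = axis (head a) 1 - axis (tail a) 1"

definition root_polytope :: "(real ^ 'm::finite) set" where
  "root_polytope = convex hull (arrow_vec ` arrows)"


definition flag_complex :: "'v set \<Rightarrow> 'v set set \<Rightarrow> bool" where
  "flag_complex V \<Delta> \<longleftrightarrow>
     \<Delta> \<subseteq> Pow V \<and> {} \<in> \<Delta> \<and> (\<forall>v\<in>V. {v} \<in> \<Delta>) \<and>
     (\<forall>\<sigma>\<in>\<Delta>. \<forall>\<tau>. \<tau> \<subseteq> \<sigma> \<longrightarrow> \<tau> \<in> \<Delta>) \<and>
     (\<forall>\<sigma>. \<sigma> \<subseteq> V \<and> (\<forall>u\<in>\<sigma>. \<forall>v\<in>\<sigma>. {u, v} \<in> \<Delta>) \<longrightarrow> \<sigma> \<in> \<Delta>)"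

text \<open>
  Affine independence makes each face \<open>\<sigma>\<close> represent a simplex whose vertices are exactly the
  points of \<open>\<sigma>\<close>. Since \<open>simplicial_complex\<close> asks for faces closed under \<open>face_of\<close>, the
  collection contains the empty simplex, of dimension \<open>-1\<close>.
\<close>

definition represents_triangulation ::
    "('v \<Rightarrow> 'a::euclidean_space) \<Rightarrow> 'v set set \<Rightarrow> 'a set \<Rightarrow> bool" where
  "represents_triangulation f \<Delta> S \<longleftrightarrow>
     (\<forall>\<sigma>\<in>\<Delta>. inj_on f \<sigma> \<and> \<not> affine_dependent (f ` \<sigma>)) \<and>
     simplicial_complex ((\<lambda>\<sigma>. convex hull (f ` \<sigma>)) ` \<Delta>) \<and>
     (\<Union>\<sigma>\<in>\<Delta>. convex hull (f ` \<sigma>)) = S"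

definition same_pattern :: "'m::linorder list \<Rightarrow> 'm list \<Rightarrow> bool" where
  "same_pattern xs ys \<longleftrightarrow> length xs = length ys \<and>
     (\<forall>p<length xs. \<forall>q<length xs.
        (xs ! p < xs ! q \<longleftrightarrow> ys ! p < ys ! q) \<and> (xs ! p = xs ! q \<longleftrightarrow> ys ! p = ys ! q))"

definition uniform :: "'m::linorder arrow set set \<Rightarrow> bool" where
  "uniform \<Delta> \<longleftrightarrow>
     (\<forall>a\<in>arrows. \<forall>b\<in>arrows. \<forall>c\<in>arrows. \<forall>d\<in>arrows.
        same_pattern [tail a, tail b, head a, head b] [tail c, tail d, head c, head d] \<longrightarrow>
        ({a, b} \<in> \<Delta> \<longleftrightarrow> {c, d} \<in> \<Delta>))"

text \<open>The polytope has dimension \<open>n\<close> in an ambient space of dimension \<open>n + 1\<close>, so its boundary is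
  the relative one.\<close>

definition uniform_flag_triangulation :: "'m::{finite,linorder} arrow set set \<Rightarrow> bool" where
  "uniform_flag_triangulation \<Delta> \<longleftrightarrow>
     flag_complex arrows \<Delta> \<and>
     represents_triangulation arrow_vec \<Delta> (rel_frontier root_polytope) \<and>
     uniform \<Delta>"


datatype end_kind = T | H

definition ends :: "'m arrow \<Rightarrow> 'm set" where
  "ends a = {tail a, head a}"

definition endpoints :: "'m::linorder arrow \<Rightarrow> 'm arrow \<Rightarrow> 'm list" where
  "endpoints a b = sorted_list_of_set (ends a \<union> ends b)"

text \<open>The following three notions are meant for two arrows with four distinct endpoints.\<close>

definition pair_type :: "'m::linorder arrow \<Rightarrow> 'm arrow \<Rightarrow> end_kind list" where
  "pair_type a b = map (\<lambda>p. if p \<in> {tail a, tail b} then T else H) (endpoints a b)"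

definition nests :: "'m::linorder arrow \<Rightarrow> 'm arrow \<Rightarrow> bool" where
  "nests a b \<longleftrightarrow> (\<exists>p1 p2 p3 p4. endpoints a b = [p1, p2, p3, p4] \<and>
     {ends a, ends b} = {{p1, p4}, {p2, p3}})"

definition crosses :: "'m::linorder arrow \<Rightarrow> 'm arrow \<Rightarrow> bool" where
  "crosses a b \<longleftrightarrow> (\<exists>p1 p2 p3 p4. endpoints a b = [p1, p2, p3, p4] \<and>
     {ends a, ends b} = {{p1, p3}, {p2, p4}})"

definition does_not_nest :: "'m::linorder arrow set set \<Rightarrow> end_kind list \<Rightarrow> bool" where
  "does_not_nest \<Delta> w \<longleftrightarrow>
     (\<forall>a\<in>arrows. \<forall>b\<in>arrows. pair_type a b = w \<and> nests a b \<longrightarrow> {a, b} \<notin> \<Delta>)"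

definition does_not_cross :: "'m::linorder arrow set set \<Rightarrow> end_kind list \<Rightarrow> bool" where
  "does_not_cross \<Delta> w \<longleftrightarrow>
     (\<forall>a\<in>arrows. \<forall>b\<in>arrows. pair_type a b = w \<and> crosses a b \<longrightarrow> {a, b} \<notin> \<Delta>)"

definition lex_class :: "'m::linorder arrow set set \<Rightarrow> bool" where
  "lex_class \<Delta> \<longleftrightarrow>
     does_not_nest \<Delta> [T, H, T, H] \<and> does_not_nest \<Delta> [H, T, H, T] \<and>
     does_not_cross \<Delta> [T, H, H, T] \<and> does_not_cross \<Delta> [H, T, T, H]"


definition face_count :: "'v set set \<Rightarrow> int \<Rightarrow> nat" where
  "face_count \<Delta> d = card {\<sigma>\<in>\<Delta>. int (card \<sigma>) - 1 = d}"

definition fb_face_count :: "'m::linorder arrow set set \<Rightarrow> nat \<Rightarrow> nat \<Rightarrow> nat" where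
  "fb_face_count \<Delta> i j =
     card {\<sigma>\<in>\<Delta>. card {a\<in>\<sigma>. forward a} = i \<and> card {a\<in>\<sigma>. backward a} = j}"

end

theory Submission
  imports Defs
begin

text \<open>
  The midpoint of two arrows with disjoint sets of tails and heads lies on the boundary, and a
  supporting functional shows that the simplex of the triangulation containing it has one of the two
  diagonals of the corresponding square as an edge; two diagonals of a square cannot both be edges.
  So \<open>\<Delta>\<close> is the clique complex of a relation on arrows which, in the lex class, is determined up to
  the choice between nesting and crossing for the types \<open>TTHH\<close> and \<open>HHTT\<close>. Whatever the choices,
  the span of a forward arrow never overlaps that of a backward arrow in more than an endpoint.

  To count cliques, scan the points from left to right and keep track of the number of open tails
  (or open heads): if \<open>p\<close> is the head of a forward arrow, then it is joined to the last
  open tail (nesting) or the first open tail (crossing), and this arrow can be removed.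
  The resulting recursion does not depend on the choice. With \<open>y\<close> marking forward and \<open>z\<close> marking
  backward arrows, it is solved in terms of the generating function \<open>C(y) = 1 + x C(y) + x y C(y)\<^sup>2\<close>
  of Schroeder paths, and the generating function of all faces on \<open>n + 1\<close> points is
  \<open>(y C(y) - z C(z)) / (y - z)\<close>, whose coefficients at \<open>y\<^sup>i z\<^sup>k\<^sup>-\<^sup>i\<close> do not depend on \<open>i\<close>.
\<close>

section \<open>Edges of the triangulation\<close>

lemma arrow_vec_nth:
  "arrow_vec a $ m = (if m = head a then 1 else 0) - (if m = tail a then 1 else 0)"
  by (simp add: arrow_vec_def axis_def)

lemma sum_arrow_vec_nth:
  "(\<Sum>m\<in>A. arrow_vec a $ m) = (if head a \<in> A then 1 else 0) - (if tail a \<in> A then 1 else 0)"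
  by (simp add: arrow_vec_nth sum_subtractf)

lemma arrow_vec_in_root_polytope: "i \<noteq> j \<Longrightarrow> arrow_vec (i, j) \<in> root_polytope"
  unfolding root_polytope_def by (rule hull_inc) (auto simp: arrows_def)

lemma convex_root_polytope: "convex root_polytope"
  by (simp add: root_polytope_def)

lemma uminus_root_polytope:
  fixes x :: "real ^ 'm::finite"
  assumes "x \<in> root_polytope"
  shows "- x \<in> root_polytope"
proof -
  have neg: "- arrow_vec a = arrow_vec (prod.swap a)" for a :: "'m arrow"
    by (simp add: arrow_vec_def)
  have "(*\<^sub>R) (- 1) ` (root_polytope :: (real ^ 'm) set) = convex hull ((*\<^sub>R) (- 1) ` arrow_vec ` (arrows :: 'm arrow set))"
    unfolding root_polytope_def by (simp only: convex_hull_scaling)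
  also have "\<dots> \<subseteq> root_polytope"
    unfolding root_polytope_def
    by (rule hull_mono) (auto simp: neg arrows_def image_image)
  finally show ?thesis using assms by auto
qed

text \<open>By central symmetry every segment from a point \<open>x\<close> of the polytope to the
  origin extends to \<open>- x\<close>.\<close>

lemma zero_in_rel_interior_root_polytope:
  assumes "(root_polytope :: (real ^ 'm::finite) set) \<noteq> {}"
  shows "0 \<in> rel_interior (root_polytope :: (real ^ 'm) set)"
  unfolding convex_rel_interior_iff[OF convex_root_polytope assms]
proof
  fix x :: "real ^ 'm" assume "x \<in> root_polytope"
  then have "(1 - 2) *\<^sub>R x + 2 *\<^sub>R 0 \<in> root_polytope" using uminus_root_polytope by auto
  then show "\<exists>e>1. (1 - e) *\<^sub>R x + e *\<^sub>R 0 \<in> root_polytope" by (intro exI[of _ 2]) simp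
qed

text \<open>If \<open>x\<close> were a relative interior point, the segment from \<open>- x\<close>
  to \<open>x\<close> could be prolonged. Along it \<open>f\<close> grows from \<open>- c\<close> to
  \<open>c\<close>, so it would exceed its maximum.\<close>

lemma supporting_imp_rel_frontier_root_polytope:
  fixes x :: "real ^ 'm::finite"
  assumes x: "x \<in> root_polytope" and f: "linear f" "f x = (c :: real)" "c > 0"
    and le: "\<And>y. y \<in> root_polytope \<Longrightarrow> f y \<le> c"
  shows "x \<in> rel_frontier root_polytope"
proof -
  have "x \<notin> rel_interior root_polytope"
  proof
    assume "x \<in> rel_interior root_polytope"
    then obtain e where e: "e > 1" "(1 - e) *\<^sub>R (- x) + e *\<^sub>R x \<in> root_polytope"
      using convex_rel_interior_iff[OF convex_root_polytope] uminus_root_polytope[OF x] x by blast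
    have "f ((1 - e) *\<^sub>R (- x) + e *\<^sub>R x) = (2 * e - 1) * c"
      unfolding linear_add[OF f(1)] linear_scale[OF f(1)] linear_neg[OF f(1)] f(2)
      by (simp add: algebra_simps)
    moreover have "(2 * e - 1) * c > 1 * c" using e f(3) by (intro mult_strict_right_mono) auto
    ultimately show False using le[OF e(2)] by simp
  qed
  then show ?thesis using x closure_subset by (auto simp: rel_frontier_def)
qed

text \<open>For disjoint nonempty \<open>I\<close> and \<open>J\<close> the maximum over the
  polytope is 2, attained exactly on the face spanned by the arrows from \<open>I\<close> to
  \<open>J\<close>.\<close>

definition facet_functional :: "'m set \<Rightarrow> 'm set \<Rightarrow> real ^ 'm::finite \<Rightarrow> real" where
  "facet_functional I J x = (\<Sum>j\<in>J. x $ j) - (\<Sum>i\<in>I. x $ i)"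

lemma linear_facet_functional: "linear (facet_functional I J)"
  by (rule linearI) (simp_all add: facet_functional_def sum.distrib sum_distrib_left right_diff_distrib)

lemma facet_functional_arrow_vec:
  assumes "I \<inter> J = {}"
  shows "facet_functional I J (arrow_vec a) \<le> 2"
    and "facet_functional I J (arrow_vec a) = 2 \<longleftrightarrow> tail a \<in> I \<and> head a \<in> J"
  using assms by (auto simp: facet_functional_def sum_arrow_vec_nth)

lemma facet_functional_le:
  fixes x :: "real ^ 'm::finite"
  assumes "I \<inter> J = {}" "x \<in> root_polytope"
  shows "facet_functional I J x \<le> 2"
proof -
  have "convex {x. facet_functional I J x \<le> 2}"
  proof (rule convexI)
    fix x y :: "real ^ 'm" and u v :: real
    assume "x \<in> {x. facet_functional I J x \<le> 2}" "y \<in> {x. facet_functional I J x \<le> 2}"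
      and uv: "0 \<le> u" "0 \<le> v" "u + v = 1"
    then have "u * facet_functional I J x + v * facet_functional I J y \<le> 2"
      by (intro convex_bound_le) auto
    then show "u *\<^sub>R x + v *\<^sub>R y \<in> {x. facet_functional I J x \<le> 2}"
      by (simp add: linear_add[OF linear_facet_functional] linear_scale[OF linear_facet_functional])
  qed
  then have "root_polytope \<subseteq> {x. facet_functional I J x \<le> 2}"
    unfolding root_polytope_def
    by (intro hull_minimal) (auto simp: facet_functional_arrow_vec[OF assms(1)])
  then show ?thesis using assms(2) by auto
qed

lemma midpoint_in_convex_hull: "{a, b} \<subseteq> A \<Longrightarrow> midpoint a b \<in> convex hull A"
  using hull_mono[of "{a, b}" A convex] midpoint_in_closed_segment[of a b]
  unfolding segment_convex_hull by blast

section \<open>Edges forced or excluded by the triangulation\<close>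

lemma triangulation_subset_closed:
  "uniform_flag_triangulation \<Delta> \<Longrightarrow> \<sigma> \<in> \<Delta> \<Longrightarrow> \<tau> \<subseteq> \<sigma> \<Longrightarrow> \<tau> \<in> \<Delta>"
  unfolding uniform_flag_triangulation_def flag_complex_def by metis

lemma triangulation_subset_arrows:
  assumes "uniform_flag_triangulation \<Delta>" "\<sigma> \<in> \<Delta>"
  shows "\<sigma> \<subseteq> arrows"
proof -
  have "\<Delta> \<subseteq> Pow arrows"
    using assms(1) unfolding uniform_flag_triangulation_def flag_complex_def by (elim conjE)
  then show ?thesis using assms(2) by auto
qed

lemma triangulation_hull_subset:
  assumes "uniform_flag_triangulation \<Delta>" "\<sigma> \<in> \<Delta>"
  shows "convex hull (arrow_vec ` \<sigma>) \<subseteq> rel_frontier root_polytope"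
proof -
  have "(\<Union>\<sigma>\<in>\<Delta>. convex hull (arrow_vec ` \<sigma>)) = rel_frontier root_polytope"
    using assms(1) unfolding uniform_flag_triangulation_def represents_triangulation_def
    by (elim conjE)
  then show ?thesis using assms(2) by blast
qed

text \<open>The midpoint of the first pair lies on the face of the arrows from
  \<open>{i1, i2}\<close> to \<open>{j1, j2}\<close>. A simplex containing it gives nonzero weight
  only to such arrows, and these must meet all four points. Shared ends are allowed; the two pairs
  then coincide.\<close>

lemma triangulation_diagonal:
  fixes \<Delta> :: "'m::{finite,linorder} arrow set set"
  assumes \<Delta>: "uniform_flag_triangulation \<Delta>" and ij: "{i1, i2} \<inter> {j1, j2} = {}"
  shows "{(i1, j1), (i2, j2)} \<in> \<Delta> \<or> {(i1, j2), (i2, j1)} \<in> \<Delta>"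
proof -
  define x :: "(real, 'm) vec" where "x = midpoint (arrow_vec (i1, j1)) (arrow_vec (i2, j2))"
  let ?F = "facet_functional {i1, i2} {j1, j2}"
  have "?F (arrow_vec (i1, j1)) = 2" "?F (arrow_vec (i2, j2)) = 2"
    by (simp_all add: facet_functional_arrow_vec(2)[OF ij])
  then have Fx: "?F x = 2"
    by (simp add: x_def midpoint_def linear_add[OF linear_facet_functional] linear_scale[OF linear_facet_functional])
  have "x \<in> root_polytope"
    unfolding x_def root_polytope_def using ij
    by (intro midpoint_in_convex_hull) (auto simp: arrows_def)
  then have "x \<in> rel_frontier root_polytope"
    by (rule supporting_imp_rel_frontier_root_polytope[OF _ linear_facet_functional Fx])
      (auto intro: facet_functional_le[OF ij])
  then obtain \<sigma> where \<sigma>: "\<sigma> \<in> \<Delta>" "x \<in> convex hull (arrow_vec ` \<sigma>)" "inj_on arrow_vec \<sigma>"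
    using \<Delta> by (auto simp: uniform_flag_triangulation_def represents_triangulation_def)
  then obtain v where v: "\<forall>y\<in>arrow_vec ` \<sigma>. 0 \<le> v y" "sum v (arrow_vec ` \<sigma>) = 1"
      "(\<Sum>y\<in>arrow_vec ` \<sigma>. v y *\<^sub>R y) = x"
    by (auto simp: convex_hull_finite)
  define u where "u a = v (arrow_vec a)" for a
  have u: "\<And>a. a \<in> \<sigma> \<Longrightarrow> 0 \<le> u a" "sum u \<sigma> = 1" "(\<Sum>a\<in>\<sigma>. u a *\<^sub>R arrow_vec a) = x"
    using v \<sigma>(3) by (auto simp: u_def sum.reindex)
  \<comment> \<open>Nonnegative weights times nonnegative gaps to the maximum add up to zero, so
    arrows off the face have weight zero.\<close>
  have "(\<Sum>a\<in>\<sigma>. u a * (2 - ?F (arrow_vec a))) = 2 * sum u \<sigma> - ?F x"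
    unfolding u(3)[symmetric] linear_sum[OF linear_facet_functional] linear_scale[OF linear_facet_functional]
    by (simp add: sum_distrib_left sum_distrib_right sum_subtractf algebra_simps)
  also have "\<dots> = 0" using u(2) Fx by simp
  finally have *: "\<forall>a\<in>\<sigma>. u a * (2 - ?F (arrow_vec a)) = 0"
    using u(1) facet_functional_arrow_vec(1)[OF ij] by (subst (asm) sum_nonneg_eq_0_iff) auto
  have supp: "tail a \<in> {i1, i2} \<and> head a \<in> {j1, j2}" if "a \<in> \<sigma>" "u a \<noteq> 0" for a
  proof -
    have "?F (arrow_vec a) = 2" using * that by auto
    then show ?thesis by (simp only: facet_functional_arrow_vec(2)[OF ij])
  qed
  have x_nth: "x $ m = (\<Sum>a\<in>\<sigma>. u a * arrow_vec a $ m)" for m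
    by (simp add: u(3)[symmetric])
  \<comment> \<open>\<open>x $ i\<close> is negative, and only an arrow with tail \<open>i\<close>
    contributes negatively to it.\<close>
  have tails: "\<exists>j. (i, j) \<in> \<sigma> \<and> u (i, j) \<noteq> 0" if "i \<in> {i1, i2}" for i
  proof (rule ccontr)
    assume none: "\<not> ?thesis"
    have "x $ i \<ge> 0" unfolding x_nth
    proof (rule sum_nonneg)
      fix a assume a: "a \<in> \<sigma>"
      show "0 \<le> u a * arrow_vec a $ i"
      proof (cases "u a = 0")
        case False
        then have "tail a \<noteq> i" using none a by (cases a) auto
        moreover have "head a \<noteq> i" using supp[OF a False] ij that by auto
        ultimately show ?thesis using u(1)[OF a] by (simp add: arrow_vec_nth)
      qed simp
    qed
    moreover have "x $ i < 0" using ij that by (auto simp: x_def midpoint_def arrow_vec_nth)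
    ultimately show False by simp
  qed
  have heads: "\<exists>i. (i, j) \<in> \<sigma> \<and> u (i, j) \<noteq> 0" if "j \<in> {j1, j2}" for j
  proof (rule ccontr)
    assume none: "\<not> ?thesis"
    have "x $ j \<le> 0" unfolding x_nth
    proof (rule sum_nonpos)
      fix a assume a: "a \<in> \<sigma>"
      show "u a * arrow_vec a $ j \<le> 0"
      proof (cases "u a = 0")
        case False
        then have "head a \<noteq> j" using none a by (cases a) auto
        moreover have "tail a \<noteq> j" using supp[OF a False] ij that by auto
        ultimately show ?thesis using u(1)[OF a] by (simp add: arrow_vec_nth)
      qed simp
    qed
    moreover have "x $ j > 0" using ij that by (auto simp: x_def midpoint_def arrow_vec_nth)
    ultimately show False by simp
  qed
  \<comment> \<open>In the bipartite graph between tails and heads, edges covering all four points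
    contain a perfect matching.\<close>
  have "{(i1, j1), (i2, j2)} \<subseteq> \<sigma> \<or> {(i1, j2), (i2, j1)} \<subseteq> \<sigma>"
  proof -
    obtain j i where "(i1, j) \<in> \<sigma>" "u (i1, j) \<noteq> 0" "(i, j2) \<in> \<sigma>" "u (i, j2) \<noteq> 0"
      using tails[of i1] heads[of j2] by auto
    moreover obtain j' i' where "(i2, j') \<in> \<sigma>" "u (i2, j') \<noteq> 0" "(i', j1) \<in> \<sigma>" "u (i', j1) \<noteq> 0"
      using tails[of i2] heads[of j1] by auto
    ultimately show ?thesis
      using supp[of "(i1, j)"] supp[of "(i2, j')"] supp[of "(i, j2)"] supp[of "(i', j1)"] by auto
  qed
  then show ?thesis using triangulation_subset_closed[OF \<Delta> \<sigma>(1)] by blast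
qed

text \<open>Both diagonals have the same midpoint. It is interior to the segment \<open>S\<close>,
  so the common face of the two simplices would contain the ends of \<open>S\<close>.\<close>

lemma triangulation_not_both_diagonals:
  fixes \<Delta> :: "'m::{finite,linorder} arrow set set"
  assumes \<Delta>: "uniform_flag_triangulation \<Delta>" and ij: "{i1, i2} \<inter> {j1, j2} = {}"
    and neq: "i1 \<noteq> i2" "j1 \<noteq> j2" and e: "{(i1, j1), (i2, j2)} \<in> \<Delta>"
  shows "{(i1, j2), (i2, j1)} \<notin> \<Delta>"
proof
  assume "{(i1, j2), (i2, j1)} \<in> \<Delta>"
  let ?v = "arrow_vec :: 'm arrow \<Rightarrow> (real, 'm) vec"
  define S where "S = convex hull {?v (i1, j1), ?v (i2, j2)}"
  define R where "R = convex hull {?v (i1, j2), ?v (i2, j1)}"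
  have "S \<in> (\<lambda>\<sigma>. convex hull (?v ` \<sigma>)) ` \<Delta>" "R \<in> (\<lambda>\<sigma>. convex hull (?v ` \<sigma>)) ` \<Delta>"
    unfolding S_def R_def using e \<open>{(i1, j2), (i2, j1)} \<in> \<Delta>\<close> by force+
  then have face: "S \<inter> R face_of S"
    using \<Delta> unfolding uniform_flag_triangulation_def represents_triangulation_def simplicial_complex_def
    by blast
  let ?m = "midpoint (?v (i1, j1)) (?v (i2, j2))"
  have m: "?m = midpoint (?v (i1, j2)) (?v (i2, j1))"
    by (simp add: midpoint_def arrow_vec_def algebra_simps)
  have "?m \<in> R" unfolding m R_def by (rule midpoint_in_convex_hull) simp
  moreover have "?m \<in> S" unfolding S_def by (rule midpoint_in_convex_hull) simp
  moreover have "?v (i1, j1) $ i1 \<noteq> ?v (i2, j2) $ i1" using ij neq by (auto simp: arrow_vec_nth)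
  then have "?m \<in> open_segment (?v (i1, j1)) (?v (i2, j2))" by auto
  moreover have "?v (i1, j1) \<in> S" "?v (i2, j2) \<in> S" unfolding S_def by (auto intro: hull_inc)
  ultimately have "?v (i1, j1) \<in> R" using face unfolding face_of_def by blast
  \<comment> \<open>Both ends of \<open>R\<close> give the value 1, whereas
    \<open>?v (i1, j1)\<close> gives 2.\<close>
  moreover have "R \<subseteq> {x. x $ j1 - x $ i1 \<le> 1}"
    unfolding R_def
  proof (rule hull_minimal)
    show "convex {x :: (real, 'm) vec. x $ j1 - x $ i1 \<le> 1}"
      using convex_halfspace_le[of "axis j1 1 - axis i1 1 :: (real, 'm) vec" 1]
      by (simp add: inner_diff_left inner_axis')
  qed (use ij neq in \<open>auto simp: arrow_vec_nth\<close>)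
  moreover have "?v (i1, j1) $ j1 - ?v (i1, j1) $ i1 = 2" using ij by (auto simp add: arrow_vec_nth)
  ultimately show False by auto
qed

text \<open>For consecutive arrows the midpoint is half the vector of the composed arrow, or zero if
  the arrows are opposite. Either way it lies in the relative interior, not on the boundary.\<close>

lemma triangulation_head_neq_tail:
  fixes \<Delta> :: "'m::{finite,linorder} arrow set set"
  assumes \<Delta>: "uniform_flag_triangulation \<Delta>" and e: "{a, b} \<in> \<Delta>"
  shows "head a \<noteq> tail b"
proof
  assume ab: "head a = tail b"
  let ?m = "midpoint (arrow_vec a) (arrow_vec b)"
  have arr: "a \<in> arrows" "b \<in> arrows"
    using triangulation_subset_arrows[OF \<Delta> e] by auto
  have "?m \<in> convex hull (arrow_vec ` {a, b})"
    by (rule midpoint_in_convex_hull) simp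
  then have "?m \<in> rel_frontier root_polytope"
    using triangulation_hull_subset[OF \<Delta> e] by blast
  then have notint: "?m \<notin> rel_interior root_polytope" by (simp add: rel_frontier_def)
  have "arrow_vec a \<in> root_polytope" using arrow_vec_in_root_polytope[of "tail a" "head a"] arr
    by (auto simp: arrows_def)
  then have zero: "0 \<in> rel_interior (root_polytope :: ((real, 'm) vec) set)"
    by (intro zero_in_rel_interior_root_polytope) auto
  have m: "?m = (1 / 2) *\<^sub>R arrow_vec (tail a, head b)"
    using ab by (simp add: midpoint_def arrow_vec_def)
  show False
  proof (cases "tail a = head b")
    case True
    then have "?m = 0" unfolding m by (simp add: arrow_vec_def)
    then show False using zero notint by simp
  next
    case False
    have "arrow_vec (tail a, head b) - (1 / 2) *\<^sub>R (arrow_vec (tail a, head b) - 0)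
        \<in> rel_interior (root_polytope :: (real, 'm) vec set)"
      using arrow_vec_in_root_polytope[OF False] closure_subset
      by (intro rel_interior_closure_convex_shrink[OF convex_root_polytope zero]) auto
    moreover have "arrow_vec (tail a, head b) - (1 / 2) *\<^sub>R (arrow_vec (tail a, head b) - 0) = ?m"
      unfolding m by (simp add: vec_eq_iff)
    ultimately show False using notint by simp
  qed
qed

section \<open>Cliques of a lex class relation\<close>

definition reverse_adj :: "('m arrow \<Rightarrow> 'm arrow \<Rightarrow> bool) \<Rightarrow> 'm arrow \<Rightarrow> 'm arrow \<Rightarrow> bool" where
  "reverse_adj E a b \<longleftrightarrow> E (prod.swap a) (prod.swap b)"

text \<open>The three clauses record the lex class: arrows of types \<open>THTH\<close> and \<open>THHT\<close> are joined only if
  their spans are disjoint, and \<open>nest\<close> is the choice for \<open>TTHH\<close>. Reversing all arrows yields the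
  clauses for \<open>HTHT\<close>, \<open>HTTH\<close> and \<open>HHTT\<close>.\<close>

definition lex_half :: "('m::linorder arrow \<Rightarrow> 'm arrow \<Rightarrow> bool) \<Rightarrow> bool \<Rightarrow> bool" where
  "lex_half E nest \<longleftrightarrow>
     (\<forall>t p i j. t < p \<and> p < i \<and> p < j \<and> i \<noteq> j \<longrightarrow> E (t, p) (i, j)) \<and>
     (\<forall>t p h s. t < p \<and> p < h \<and> p < s \<longrightarrow> \<not> E (t, h) (s, p)) \<and>
     (\<forall>i k p h. i < k \<and> k < p \<and> p < h \<longrightarrow>
        (E (i, h) (k, p) \<longleftrightarrow> nest) \<and> (E (i, p) (k, h) \<longleftrightarrow> \<not> nest))"

text \<open>This is all the count uses of the triangulation. For \<open>a = b\<close> the third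
  clause makes every arrow adjacent to itself and the second excludes \<open>(i, i)\<close>, so
  cliques consist of arrows.\<close>

definition lex_adj :: "('m::linorder arrow \<Rightarrow> 'm arrow \<Rightarrow> bool) \<Rightarrow> bool \<Rightarrow> bool \<Rightarrow> bool" where
  "lex_adj E nest_f nest_b \<longleftrightarrow>
     (\<forall>a b. E a b \<longrightarrow> E b a) \<and>
     (\<forall>a b. E a b \<longrightarrow> head a \<noteq> tail b) \<and>
     (\<forall>a\<in>arrows. \<forall>b\<in>arrows. tail a = tail b \<or> head a = head b \<longrightarrow> E a b) \<and>
     lex_half E nest_f \<and> lex_half (reverse_adj E) nest_b"

text \<open>\<open>A\<close> and \<open>B\<close> are the allowed tails and heads, \<open>R\<close> and \<open>S\<close> those that have to occur.\<close>

definition faces :: "('m arrow \<Rightarrow> 'm arrow \<Rightarrow> bool) \<Rightarrow> 'm set \<Rightarrow> 'm set \<Rightarrow> 'm set \<Rightarrow> 'm set \<Rightarrow> 'm arrow set set"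
  where "faces E A B R S =
    {\<sigma>. \<sigma> \<subseteq> A \<times> B \<and> (\<forall>a\<in>\<sigma>. \<forall>b\<in>\<sigma>. E a b) \<and> R \<subseteq> tail ` \<sigma> \<and> S \<subseteq> head ` \<sigma>}"

definition weight :: "'a::comm_ring_1 \<Rightarrow> 'a \<Rightarrow> 'm::linorder arrow set \<Rightarrow> 'a" where
  "weight y z \<sigma> = y ^ card {a\<in>\<sigma>. forward a} * z ^ card {a\<in>\<sigma>. backward a}"

section \<open>Reversal of arrows, and the adjacency clauses in pointwise form\<close>

lemma reverse_adj_reverse_adj [simp]: "reverse_adj (reverse_adj E) = E"
  by (simp add: reverse_adj_def fun_eq_iff)

lemma lex_adj_sym: "lex_adj E nf nb \<Longrightarrow> E a b \<Longrightarrow> E b a"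
  unfolding lex_adj_def by blast

lemma lex_adj_reverse:
  assumes E: "lex_adj E nf nb"
  shows "lex_adj (reverse_adj E) nb nf"
proof -
  have "\<forall>a b. reverse_adj E a b \<longrightarrow> reverse_adj E b a"
    using lex_adj_sym[OF E] by (simp add: reverse_adj_def)
  moreover have "head a \<noteq> tail b" if "reverse_adj E a b" for a b
    using that lex_adj_sym[OF E] E unfolding lex_adj_def reverse_adj_def
    by (metis fst_swap snd_swap)
  moreover have "reverse_adj E a b"
    if "a \<in> arrows" "b \<in> arrows" "tail a = tail b \<or> head a = head b" for a b
  proof -
    have "prod.swap a \<in> arrows" "prod.swap b \<in> arrows" using that by (auto simp: arrows_def)
    then show ?thesis using that E unfolding lex_adj_def reverse_adj_def by (metis fst_swap snd_swap)
  qed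
  ultimately show ?thesis
    using E unfolding lex_adj_def reverse_adj_reverse_adj by blast
qed

lemma lex_adj_half: "lex_adj E nf nb \<Longrightarrow> lex_half E nf"
  unfolding lex_adj_def by blast

lemma lex_adj_head_tail:
  assumes "lex_adj E nf nb" "E (i, j) (k, l)"
  shows "j \<noteq> k \<and> i \<noteq> l"
proof -
  have "head a \<noteq> tail b" if "E a b" for a b
    using assms(1) that unfolding lex_adj_def by blast
  from this[OF assms(2)] this[OF lex_adj_sym[OF assms]] show ?thesis by auto
qed

lemma lex_adj_share:
  assumes "lex_adj E nf nb" "i \<noteq> j" "k \<noteq> l" "i = k \<or> j = l"
  shows "E (i, j) (k, l)"
proof -
  have "(i, j) \<in> arrows" "(k, l) \<in> arrows" using assms by (auto simp: arrows_def)
  moreover have "E a b" if "a \<in> arrows" "b \<in> arrows" "tail a = tail b \<or> head a = head b" for a b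
    using assms(1) that unfolding lex_adj_def by blast
  ultimately show ?thesis using assms(4) by auto
qed

lemma lex_adj_apart:
  "lex_adj E nf nb \<Longrightarrow> t < p \<Longrightarrow> p < i \<Longrightarrow> p < j \<Longrightarrow> i \<noteq> j \<Longrightarrow> E (t, p) (i, j)"
  by (drule lex_adj_half) (simp add: lex_half_def)

lemma lex_adj_overlap:
  "lex_adj E nf nb \<Longrightarrow> t < p \<Longrightarrow> p < h \<Longrightarrow> p < s \<Longrightarrow> \<not> E (t, h) (s, p)"
  by (drule lex_adj_half) (simp add: lex_half_def)

lemma lex_adj_nest:
  "lex_adj E nf nb \<Longrightarrow> i < k \<Longrightarrow> k < p \<Longrightarrow> p < h \<Longrightarrow> E (i, h) (k, p) \<longleftrightarrow> nf"
  by (drule lex_adj_half) (simp add: lex_half_def)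

lemma lex_adj_cross:
  "lex_adj E nf nb \<Longrightarrow> i < k \<Longrightarrow> k < p \<Longrightarrow> p < h \<Longrightarrow> E (i, p) (k, h) \<longleftrightarrow> \<not> nf"
  by (drule lex_adj_half) (simp add: lex_half_def)

lemma faces_tails: "\<sigma> \<in> faces E A B R S \<Longrightarrow> R \<subseteq> tail ` \<sigma> \<and> tail ` \<sigma> \<subseteq> A"
  by (auto simp: faces_def)

lemma faces_heads: "\<sigma> \<in> faces E A B R S \<Longrightarrow> S \<subseteq> head ` \<sigma> \<and> head ` \<sigma> \<subseteq> B"
  by (auto simp: faces_def)

lemma faces_reverse:
  "faces (reverse_adj E) B A S R = (\<lambda>\<sigma>. prod.swap ` \<sigma>) ` faces E A B R S"
proof -
  \<comment> \<open>Reversal is an involution, so this inclusion, stated for all relations, also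
    yields the opposite one.\<close>
  have sub: "(\<lambda>\<sigma>. prod.swap ` \<sigma>) ` faces E A B R S \<subseteq> faces (reverse_adj E) B A S R"
    for E :: "'a arrow \<Rightarrow> 'a arrow \<Rightarrow> bool" and A B R S
  proof (rule image_subsetI)
    fix \<sigma> assume s: "\<sigma> \<in> faces E A B R S"
    have "tail ` prod.swap ` \<sigma> = head ` \<sigma>" "head ` prod.swap ` \<sigma> = tail ` \<sigma>"
      by (simp_all add: image_comp)
    then show "prod.swap ` \<sigma> \<in> faces (reverse_adj E) B A S R"
      using s by (force simp: faces_def reverse_adj_def)
  qed
  show ?thesis
  proof
    show "faces (reverse_adj E) B A S R \<subseteq> (\<lambda>\<sigma>. prod.swap ` \<sigma>) ` faces E A B R S"
    proof
      fix \<sigma> assume "\<sigma> \<in> faces (reverse_adj E) B A S R"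
      then have "prod.swap ` \<sigma> \<in> faces E A B R S"
        using sub[of "reverse_adj E" B A S R] by auto
      then show "\<sigma> \<in> (\<lambda>\<sigma>. prod.swap ` \<sigma>) ` faces E A B R S"
        by (rule rev_image_eqI) (simp add: image_comp)
    qed
  qed (rule sub)
qed

lemma weight_reverse: "weight y z (prod.swap ` \<sigma>) = weight z y \<sigma>"
proof -
  have "{a \<in> prod.swap ` \<sigma>. forward a} = prod.swap ` {a \<in> \<sigma>. backward a}"
    and "{a \<in> prod.swap ` \<sigma>. backward a} = prod.swap ` {a \<in> \<sigma>. forward a}"
    by (auto simp: forward_def backward_def)
  then show ?thesis
    by (simp add: weight_def card_image mult.commute)
qed

lemma sum_weight_reverse:
  "sum (weight y z) (faces (reverse_adj E) B A S R) = sum (weight z y) (faces E A B R S)"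
proof -
  have "inj_on (\<lambda>\<sigma>. prod.swap ` \<sigma>) (faces E A B R S)"
    by (rule inj_on_inverseI[where g = "\<lambda>\<sigma>. prod.swap ` \<sigma>"]) (simp add: image_comp)
  then show ?thesis by (simp add: faces_reverse sum.reindex weight_reverse)
qed

section \<open>Recursions for faces with open tails\<close>

text \<open>An arrow that neither shares an end with \<open>(t, p)\<close> nor lies entirely to its
  right runs from another open tail to a point beyond \<open>p\<close>. The choice of
  \<open>t\<close> makes it nest with \<open>(t, p)\<close> if \<open>nf\<close> holds and cross it
  otherwise, which is the joined position.\<close>

lemma lex_adj_extend:
  assumes E: "lex_adj E nf nb"
    and Q: "\<forall>q\<in>Q. q < p" and M: "\<forall>m\<in>M. p < m"
    and t: "t \<in> Q" "\<forall>q\<in>Q. if nf then q \<le> t else t \<le> q"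
    and a: "i \<in> Q \<union> M" "j \<in> insert p M" "E (i, j) (i, j)"
  shows "E (t, p) (i, j)"
proof -
  have ij: "i \<noteq> j" using lex_adj_head_tail[OF E a(3)] by auto
  have tp: "t < p" using Q t(1) by auto
  consider "j = p \<or> i = t" | "i \<in> M" "j \<in> M" | "i \<in> Q" "i \<noteq> t" "j \<in> M"
    using a by auto
  then show ?thesis
  proof cases
    case 1 then show ?thesis using lex_adj_share[OF E, of t p i j] ij tp by auto
  next
    case 2 then show ?thesis using lex_adj_apart[OF E tp _ _ ij] M by auto
  next
    case 3
    have "p < j" "i < p" using 3 M Q by auto
    show ?thesis
    proof (cases nf)
      case True
      then have "i < t" using t(2)[rule_format, OF 3(1)] 3(2) by simp
      then show ?thesis using lex_adj_nest[OF E _ tp \<open>p < j\<close>, of i] True lex_adj_sym[OF E] by auto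
    next
      case False
      then have "t < i" using t(2)[rule_format, OF 3(1)] 3(2) by simp
      then show ?thesis using lex_adj_cross[OF E _ \<open>i < p\<close> \<open>p < j\<close>, of t] False by auto
    qed
  qed
qed

text \<open>If \<open>s\<close> is an open tail, this is the other pairing of the four points
  considered for \<open>lex_adj_extend\<close>, hence not joined. If \<open>s\<close> lies beyond
  \<open>p\<close>, a forward and a backward arrow overlap.\<close>

lemma lex_adj_blocked:
  assumes E: "lex_adj E nf nb"
    and Q: "\<forall>q\<in>Q. q < p" and M: "\<forall>m\<in>M. p < m"
    and t: "t \<in> Q" "\<forall>q\<in>Q. if nf then q \<le> t else t \<le> q"
    and h: "h \<in> M" and s: "s \<in> Q \<union> M" "s \<noteq> t"
  shows "\<not> E (t, h) (s, p)"
proof -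
  have tp: "t < p" "p < h" using Q M t(1) h by auto
  consider "s \<in> M" | "s \<in> Q" using s by auto
  then show ?thesis
  proof cases
    case 1 then show ?thesis using lex_adj_overlap[OF E tp] M by auto
  next
    case 2
    have "s < p" using 2 Q by auto
    show ?thesis
    proof (cases nf)
      case True
      then have "s < t" using t(2)[rule_format, OF 2] s by simp
      then show ?thesis using lex_adj_cross[OF E _ tp, of s] True lex_adj_sym[OF E] by auto
    next
      case False
      then have "t < s" using t(2)[rule_format, OF 2] s by simp
      then show ?thesis using lex_adj_nest[OF E _ \<open>s < p\<close> tp(2), of t] False by auto
    qed
  qed
qed

text \<open>The arrow \<open>(t, p)\<close> is forced: an arrow into \<open>p\<close> from elsewhere blocks all arrows from \<open>t\<close> to a
  point beyond \<open>p\<close>. For the same reason \<open>t\<close> and \<open>p\<close> cannot both have further neighbours, whence the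
  three cases.\<close>

lemma faces_head_step:
  assumes E: "lex_adj E nf nb"
    and Q: "\<forall>q\<in>Q. q < p" and M: "\<forall>m\<in>M. p < m"
    and t: "t \<in> Q" "\<forall>q\<in>Q. if nf then q \<le> t else t \<le> q"
  shows "faces E (Q \<union> M) (insert p M) Q {p} = insert (t, p) `
    (faces E (Q \<union> M) M Q {} \<union>
     (faces E (Q - {t} \<union> M) (insert p M) (Q - {t}) {p} \<union>
      faces E (Q - {t} \<union> M) M (Q - {t}) {}))"
    (is "?L = insert (t, p) ` (?A \<union> (?B \<union> ?C))")
proof
  have blocked: "\<not> E (t, h) (s, p)" if "h \<in> M" "s \<in> Q \<union> M" "s \<noteq> t" for h s
    using lex_adj_blocked[OF E Q M t] that by blast
  have extend: "E (t, p) (i, j)" if "i \<in> Q \<union> M" "j \<in> insert p M" "E (i, j) (i, j)" for i j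
    using lex_adj_extend[OF E Q M t] that by blast
  show "?L \<subseteq> insert (t, p) ` (?A \<union> (?B \<union> ?C))"
  proof
    fix \<sigma> assume s: "\<sigma> \<in> ?L"
    then have sub: "\<sigma> \<subseteq> (Q \<union> M) \<times> insert p M" and cl: "\<And>a b. a \<in> \<sigma> \<Longrightarrow> b \<in> \<sigma> \<Longrightarrow> E a b"
      and tl: "Q \<subseteq> tail ` \<sigma>" and "p \<in> head ` \<sigma>"
      by (auto simp: faces_def)
    obtain s where s: "(s, p) \<in> \<sigma>" using \<open>p \<in> head ` \<sigma>\<close> by auto
    obtain h where h: "(t, h) \<in> \<sigma>" using t(1) tl by auto
    have tp: "(t, p) \<in> \<sigma>"
    proof (rule ccontr)
      assume n: "(t, p) \<notin> \<sigma>"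
      then have "s \<noteq> t" "h \<noteq> p" using s h by auto
      then show False using blocked[of h s] cl[OF h s] sub s h by auto
    qed
    define \<rho> where "\<rho> = \<sigma> - {(t, p)}"
    have \<sigma>: "\<sigma> = insert (t, p) \<rho>" using tp by (auto simp: \<rho>_def)
    have tl': "Q - {t} \<subseteq> tail ` \<rho>"
    proof
      fix q assume q: "q \<in> Q - {t}"
      then obtain b where "b \<in> \<sigma>" "tail b = q" using tl by auto
      then have "b \<in> \<rho>" using q by (auto simp: \<rho>_def)
      then show "q \<in> tail ` \<rho>" using \<open>tail b = q\<close> by auto
    qed
    have clr: "\<forall>a\<in>\<rho>. \<forall>b\<in>\<rho>. E a b" using cl by (auto simp: \<rho>_def)
    have "\<rho> \<in> ?A \<union> (?B \<union> ?C)"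
    proof (cases "t \<in> tail ` \<rho>")
      case True
      then obtain h where h: "(t, h) \<in> \<rho>" by auto
      then have hM: "(t, h) \<in> \<sigma>" "h \<in> M" using sub by (auto simp: \<rho>_def)
      \<comment> \<open>\<open>t\<close> keeps an arrow to a point beyond \<open>p\<close>, which
        blocks any second arrow into \<open>p\<close>.\<close>
      have "snd a \<noteq> p" if "a \<in> \<rho>" for a
      proof
        assume "snd a = p"
        then have a: "(fst a, p) \<in> \<sigma>" "fst a \<noteq> t" using that by (auto simp: \<rho>_def)
        then show False using blocked[OF hM(2) _ a(2)] cl[OF hM(1) a(1)] a(1) sub by auto
      qed
      then have "\<rho> \<subseteq> (Q \<union> M) \<times> M" using sub by (force simp: \<rho>_def)
      moreover have "Q \<subseteq> tail ` \<rho>" using True tl' by auto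
      ultimately show ?thesis using clr by (simp add: faces_def)
    next
      case False
      then have sub': "\<rho> \<subseteq> (Q - {t} \<union> M) \<times> insert p M" using sub by (force simp: \<rho>_def)
      show ?thesis
      proof (cases "p \<in> head ` \<rho>")
        case True
        then show ?thesis using sub' clr tl' by (simp add: faces_def)
      next
        case False
        then have "\<rho> \<subseteq> (Q - {t} \<union> M) \<times> M" using sub' by force
        then show ?thesis using clr tl' by (simp add: faces_def)
      qed
    qed
    then show "\<sigma> \<in> insert (t, p) ` (?A \<union> (?B \<union> ?C))" using \<sigma> by blast
  qed
  show "insert (t, p) ` (?A \<union> (?B \<union> ?C)) \<subseteq> ?L"
  proof (rule image_subsetI)
    fix \<rho> assume r: "\<rho> \<in> ?A \<union> (?B \<union> ?C)"
    then have sub: "\<rho> \<subseteq> (Q \<union> M) \<times> insert p M" and cl: "\<And>a b. a \<in> \<rho> \<Longrightarrow> b \<in> \<rho> \<Longrightarrow> E a b"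
      and tl: "Q - {t} \<subseteq> tail ` \<rho>"
      by (auto simp: faces_def)
    have ext: "E (t, p) b" if "b \<in> \<rho>" for b
      using extend[of "fst b" "snd b"] cl[OF that that] sub that by (cases b) auto
    have "E (t, p) (t, p)"
      using Q[rule_format, OF t(1)] lex_adj_share[OF E, of t p t p] by auto
    then have "\<forall>a\<in>insert (t, p) \<rho>. \<forall>b\<in>insert (t, p) \<rho>. E a b"
      using ext cl lex_adj_sym[OF E] by auto
    then show "insert (t, p) \<rho> \<in> ?L"
      using sub tl t(1) by (auto simp: faces_def)
  qed
qed

lemma faces_min_step:
  assumes E: "lex_adj E nf nb"
    and Q: "\<forall>q\<in>Q. q < p" and M: "\<forall>m\<in>M. p < m"
  shows "faces E (Q \<union> insert p M) (insert p M) Q {} =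
    faces E (Q \<union> M) M Q {} \<union>
    (faces E (insert p Q \<union> M) M (insert p Q) {} \<union> faces E (Q \<union> M) (insert p M) Q {p})"
    (is "?L = ?A \<union> (?B \<union> ?C)")
proof
  show "?A \<union> (?B \<union> ?C) \<subseteq> ?L" by (auto simp: faces_def)
  show "?L \<subseteq> ?A \<union> (?B \<union> ?C)"
  proof
    fix \<sigma> assume s: "\<sigma> \<in> ?L"
    then have sub: "\<sigma> \<subseteq> (Q \<union> insert p M) \<times> insert p M" and cl: "\<And>a b. a \<in> \<sigma> \<Longrightarrow> b \<in> \<sigma> \<Longrightarrow> E a b"
      and tl: "Q \<subseteq> tail ` \<sigma>"
      by (auto simp: faces_def)
    show "\<sigma> \<in> ?A \<union> (?B \<union> ?C)"
    proof (cases "p \<in> head ` \<sigma>")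
      case True
      then have "p \<notin> tail ` \<sigma>" using cl lex_adj_head_tail[OF E] by fastforce
      then have "\<sigma> \<subseteq> (Q \<union> M) \<times> insert p M" using sub by force
      then have "\<sigma> \<in> ?C" using cl tl True by (simp add: faces_def)
      then show ?thesis by blast
    next
      case nh: False
      show ?thesis
      proof (cases "p \<in> tail ` \<sigma>")
        case True
        have "\<sigma> \<subseteq> (insert p Q \<union> M) \<times> M" using sub nh by force
        then have "\<sigma> \<in> ?B" using cl tl True by (simp add: faces_def)
        then show ?thesis by blast
      next
        case False
        then have "\<sigma> \<subseteq> (Q \<union> M) \<times> M" using sub nh by force
        then have "\<sigma> \<in> ?A" using cl tl by (simp add: faces_def)
        then show ?thesis by blast
      qed
    qed
  qed
qed

section \<open>Weighted form of the recursions\<close>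

lemma weight_insert_forward:
  fixes \<sigma> :: "'m::{finite,linorder} arrow set"
  assumes "t < p" "(t, p) \<notin> \<sigma>"
  shows "weight y z (insert (t, p) \<sigma>) = y * weight y z \<sigma>"
proof -
  have "{a \<in> insert (t, p) \<sigma>. forward a} = insert (t, p) {a \<in> \<sigma>. forward a}"
    and "{a \<in> insert (t, p) \<sigma>. backward a} = {a \<in> \<sigma>. backward a}"
    using assms by (auto simp: forward_def backward_def)
  then show ?thesis using assms by (simp add: weight_def)
qed

text \<open>The removed arrow is forward and contributes the factor \<open>y\<close>. The three
  families are told apart by whether \<open>t\<close> is still a tail and \<open>p\<close> still a
  head.\<close>

lemma sum_weight_head_step:
  fixes Q M :: "'m::{finite,linorder} set"
  assumes E: "lex_adj E nf nb"
    and Q: "\<forall>q\<in>Q. q < p" and M: "\<forall>m\<in>M. p < m"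
    and t: "t \<in> Q" "\<forall>q\<in>Q. if nf then q \<le> t else t \<le> q"
  shows "sum (weight y z) (faces E (Q \<union> M) (insert p M) Q {p}) = y *
    (sum (weight y z) (faces E (Q \<union> M) M Q {}) +
     (sum (weight y z) (faces E (Q - {t} \<union> M) (insert p M) (Q - {t}) {p}) +
      sum (weight y z) (faces E (Q - {t} \<union> M) M (Q - {t}) {})))"
    (is "?l = y * (sum _ ?A + (sum _ ?B + sum _ ?C))")
proof -
  have tp: "t < p" "t \<notin> M" "p \<notin> M" using Q[rule_format, OF t(1)] M by force+
  have new: "(t, p) \<notin> \<sigma>" if "\<sigma> \<in> ?A \<union> (?B \<union> ?C)" for \<sigma>
    using that tp by (auto simp: faces_def)
  have inj: "inj_on (insert (t, p)) (?A \<union> (?B \<union> ?C))"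
    by (rule inj_onI) (use new insert_ident in metis)
  have "?l = sum (\<lambda>\<sigma>. y * weight y z \<sigma>) (?A \<union> (?B \<union> ?C))"
    unfolding faces_head_step[OF E Q M t] sum.reindex[OF inj] o_def
    by (rule sum.cong[OF refl]) (rule weight_insert_forward[OF tp(1) new])
  also have "\<dots> = y * sum (weight y z) (?A \<union> (?B \<union> ?C))" by (simp add: sum_distrib_left)
  also have "?A \<inter> (?B \<union> ?C) = {}" "?B \<inter> ?C = {}"
    using tp t(1) by (blast dest: faces_tails faces_heads)+
  then have "sum (weight y z) (?A \<union> (?B \<union> ?C)) = sum (weight y z) ?A + (sum (weight y z) ?B + sum (weight y z) ?C)"
    by (simp add: sum.union_disjoint)
  finally show ?thesis .
qed

lemma sum_weight_min_step:
  fixes Q M :: "'m::{finite,linorder} set"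
  assumes E: "lex_adj E nf nb"
    and Q: "\<forall>q\<in>Q. q < p" and M: "\<forall>m\<in>M. p < m"
  shows "sum (weight y z) (faces E (Q \<union> insert p M) (insert p M) Q {}) =
    sum (weight y z) (faces E (Q \<union> M) M Q {}) +
    (sum (weight y z) (faces E (insert p Q \<union> M) M (insert p Q) {}) +
     sum (weight y z) (faces E (Q \<union> M) (insert p M) Q {p}))"
    (is "_ = sum _ ?A + (sum _ ?B + sum _ ?C)")
proof -
  have p: "p \<notin> M" "p \<notin> Q" using M Q by force+
  have "?A \<inter> (?B \<union> ?C) = {}" "?B \<inter> ?C = {}"
    using p by (blast dest: faces_tails faces_heads)+
  then show ?thesis unfolding faces_min_step[OF assms] by (simp add: sum.union_disjoint)
qed

section \<open>Catalan and Schroeder numbers\<close>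

unbundle fps_syntax

section \<open>Catalan numbers and their convolution\<close>

definition catalan :: "nat \<Rightarrow> nat" where
  "catalan k = ((2 * k) choose k) div (k + 1)"

text \<open>The number of Schroeder paths of semilength \<open>n\<close> with \<open>k\<close> up
  steps: among \<open>n + k\<close> steps, choose the places of the \<open>2 * k\<close> up and down
  steps, which form a Dyck path.\<close>

definition schroeder :: "nat \<Rightarrow> nat \<Rightarrow> nat" where
  "schroeder n k = ((n + k) choose (2 * k)) * catalan k"

text \<open>The division is exact because the quotient is the difference of two neighbouring
  binomial coefficients.\<close>

lemma Suc_times_catalan: "(k + 1) * catalan k = (2 * k) choose k"
proof -
  have "(k + 1) * ((2 * k) choose (k + 1)) = k * ((2 * k) choose k)"
    using binomial_absorption[of k "2 * k"] binomial_absorb_comp[of "2 * k" k]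
    by (simp only: mult_2 diff_add_inverse2 Suc_eq_plus1)
  then have "(k + 1) * (((2 * k) choose k) - ((2 * k) choose (k + 1))) = (2 * k) choose k"
    by (simp add: diff_mult_distrib2)
  then have "(k + 1) dvd ((2 * k) choose k)" by (metis dvd_triv_left)
  then show ?thesis unfolding catalan_def by (rule dvd_mult_div_cancel)
qed

lemma catalan_Suc: "(k + 2) * catalan (Suc k) = 2 * (2 * k + 1) * catalan k"
proof -
  have "(k + 1) * ((2 * k + 2) choose (k + 1)) = 2 * ((k + 1) * ((2 * k + 1) choose k))"
    using Suc_times_binomial[of k "2 * k + 1"] by (simp del: binomial_Suc_Suc)
  also have "(k + 1) * ((2 * k + 1) choose k) = (2 * k + 1) * ((2 * k) choose k)"
    using binomial_absorb_comp[of "2 * k + 1" k] by (simp del: binomial_Suc_Suc)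
  finally have "(k + 1) * ((k + 2) * catalan (Suc k)) = (k + 1) * (2 * (2 * k + 1) * catalan k)"
    unfolding Suc_times_catalan[of k, symmetric]
    using Suc_times_catalan[of "Suc k"] by (simp del: binomial_Suc_Suc) (simp add: algebra_simps)
  then show ?thesis by (simp only: mult_cancel1) simp
qed

text \<open>These are the coefficients of \<open>(1 - sqrt (1 - 4 x)) / (2 x)\<close> by the
  binomial series.\<close>

lemma catalan_gbinomial: "real (catalan k) = - 1 / 2 * (- 4) ^ (k + 1) * ((1 / 2) gchoose (k + 1))"
proof (induction k)
  case 0
  then show ?case by (simp add: catalan_def)
next
  case (Suc k)
  have "real (k + 2) * real (catalan (Suc k)) = 2 * (2 * real k + 1) * real (catalan k)"
    using arg_cong[OF catalan_Suc, of real k] by (simp only: of_nat_mult of_nat_add of_nat_numeral of_nat_1)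
  moreover have "real (k + 2) * ((1 / 2 :: real) gchoose (k + 2)) = (1 / 2 - real (k + 1)) * ((1 / 2) gchoose (k + 1))"
    using gbinomial_mult_1[of "1 / 2 :: real" "k + 1"] by (simp add: algebra_simps)
  then have "real (k + 2) * (- 1 / 2 * (- 4) ^ (k + 2) * ((1 / 2) gchoose (k + 2))) =
      2 * (- 4) ^ (k + 1) * ((1 / 2 - real (k + 1)) * ((1 / 2) gchoose (k + 1)))"
    by (simp only: mult.assoc[symmetric] mult.commute[of "real (k + 2)"])
      (simp add: mult.commute)
  ultimately have "real (k + 2) * real (catalan (Suc k)) =
      real (k + 2) * (- 1 / 2 * (- 4) ^ (k + 2) * ((1 / 2) gchoose (k + 2)))"
    unfolding Suc by (simp add: algebra_simps)
  then have "real (catalan (Suc k)) = - 1 / 2 * (- 4) ^ (k + 2) * ((1 / 2) gchoose (k + 2))"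
    by (subst (asm) mult_left_cancel) simp_all
  then show ?case by simp
qed

text \<open>The square of \<open>sqrt (1 - 4 x)\<close> has no terms of degree \<open>n + 2\<close>;
  this is Vandermonde's identity for \<open>1 / 2 + 1 / 2 = 1\<close>.\<close>

lemma catalan_convolution: "(\<Sum>i\<le>n. catalan i * catalan (n - i)) = catalan (Suc n)"
proof -
  let ?a = "\<lambda>i. (1 / 2 :: real) gchoose i"
  have "0 = (\<Sum>i\<in>{0..Suc (Suc n)}. ?a i * ?a (Suc (Suc n) - i))"
    unfolding gbinomial_Vandermonde using binomial_gbinomial[of 1 "n + 2", where 'a = real] by simp
  \<comment> \<open>The two outer terms contain the factor \<open>?a 0 = 1\<close>; in the others
    both indices are positive.\<close>
  also have "\<dots> = 2 * ?a (n + 2) + (\<Sum>i\<le>n. ?a (i + 1) * ?a (n - i + 1))"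
    unfolding atLeast0AtMost sum.atMost_Suc[of _ "Suc n"] sum.atMost_Suc_shift[of _ n]
    by (simp add: Suc_diff_le)
  finally have a: "(\<Sum>i\<le>n. ?a (i + 1) * ?a (n - i + 1)) = - 2 * ?a (n + 2)" by simp
  have "real (\<Sum>i\<le>n. catalan i * catalan (n - i)) =
      (\<Sum>i\<le>n. 1 / 4 * (- 4) ^ (n + 2) * (?a (i + 1) * ?a (n - i + 1)))"
    unfolding of_nat_sum of_nat_mult catalan_gbinomial
  proof (rule sum.cong[OF refl])
    fix i assume "i \<in> {..n}"
    then have "(- 4 :: real) ^ (n + 2) = (- 4) ^ (i + 1) * (- 4) ^ (n - i + 1)"
      by (simp flip: power_add power_Suc)
    then show "- 1 / 2 * (- 4) ^ (i + 1) * ?a (i + 1) * (- 1 / 2 * (- 4) ^ (n - i + 1) * ?a (n - i + 1)) =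
      1 / 4 * (- 4) ^ (n + 2) * (?a (i + 1) * ?a (n - i + 1))" by (simp only:) simp
  qed
  also have "\<dots> = real (catalan (Suc n))"
    unfolding sum_distrib_left[symmetric] a catalan_gbinomial by simp
  finally show ?thesis by (simp only: of_nat_eq_iff)
qed

section \<open>Convolution of Schroeder numbers\<close>

text \<open>Subsets of size \<open>r + s + 1\<close> of \<open>{0..n}\<close> are classified by
  their element \<open>u\<close> with exactly \<open>r\<close> smaller members. The induction uses
  Pascal's rule in the second factor.\<close>

lemma sum_choose_times_choose:
  "(\<Sum>u\<le>n. (u choose r) * ((n - u) choose s)) = Suc n choose Suc (r + s)"
proof (induction n arbitrary: s)
  case 0
  then show ?case by (cases r; cases s) auto
next
  case (Suc n)
  show ?case
  proof (cases s)
    case 0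
    then show ?thesis using sum_choose_upper[of r "Suc n"] by simp
  next
    case (Suc s')
    have "(\<Sum>u\<le>Suc n. (u choose r) * ((Suc n - u) choose s)) =
        (\<Sum>u\<le>n. (u choose r) * ((n - u) choose s') + (u choose r) * ((n - u) choose s))"
      by (simp add: Suc Suc_diff_le algebra_simps)
    then show ?thesis using Suc.IH[of s] Suc.IH[of s'] by (simp add: sum.distrib Suc)
  qed
qed

text \<open>After shifting the index by \<open>i\<close>, the terms missing from the full sum vanish
  because \<open>i \<le> r\<close> and \<open>j \<le> s\<close>.\<close>

lemma sum_shifted_choose_times_choose:
  assumes "i \<le> r" "j \<le> s"
  shows "(\<Sum>a\<le>n. ((a + i) choose r) * ((n - a + j) choose s)) = (n + i + j + 1) choose (r + s + 1)"
proof -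
  let ?f = "\<lambda>u. (u choose r) * ((n + i + j - u) choose s)"
  have "(\<Sum>a\<le>n. ((a + i) choose r) * ((n - a + j) choose s)) = sum ?f ((\<lambda>a. a + i) ` {..n})"
    by (subst sum.reindex) (auto intro!: sum.cong)
  also have "\<dots> = sum ?f {..n + i + j}"
  proof (rule sum.mono_neutral_left)
    show "\<forall>u\<in>{..n + i + j} - (\<lambda>a. a + i) ` {..n}. ?f u = 0"
    proof
      fix u assume u: "u \<in> {..n + i + j} - (\<lambda>a. a + i) ` {..n}"
      have "u < i \<or> u > n + i"
      proof (rule ccontr)
        assume "\<not> ?thesis"
        then have "u = (u - i) + i" "u - i \<le> n" by auto
        then show False using u by blast
      qed
      then show "?f u = 0" using assms u by (auto simp: binomial_eq_0)
    qed
  qed auto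
  finally show ?thesis using sum_choose_times_choose[of r "n + i + j" s] by simp
qed

lemma schroeder_eq_0: "n < k \<Longrightarrow> schroeder n k = 0"
  by (simp add: schroeder_def)

text \<open>A path starts with a level step, or with an up step and is then split at its first
  return. In the computation the sum over \<open>a\<close> gives a binomial coefficient free of
  \<open>i\<close>, which leaves the Catalan convolution and Pascal's rule.\<close>

lemma schroeder_convolution:
  "schroeder (Suc n) (Suc k) =
    schroeder n (Suc k) + (\<Sum>a\<le>n. \<Sum>i\<le>k. schroeder a i * schroeder (n - a) (k - i))"
proof -
  have "(\<Sum>a\<le>n. \<Sum>i\<le>k. schroeder a i * schroeder (n - a) (k - i)) =
    (\<Sum>i\<le>k. catalan i * catalan (k - i) *
      (\<Sum>a\<le>n. ((a + i) choose (2 * i)) * ((n - a + (k - i)) choose (2 * (k - i)))))"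
    by (subst sum.swap) (simp add: schroeder_def sum_distrib_left algebra_simps)
  also have "\<dots> = (\<Sum>i\<le>k. catalan i * catalan (k - i) * ((n + k + 1) choose (2 * k + 1)))"
  proof (rule sum.cong[OF refl])
    fix i assume "i \<in> {..k}"
    then have "n + i + (k - i) = n + k" "2 * i + 2 * (k - i) = 2 * k" by auto
    then show "catalan i * catalan (k - i) *
        (\<Sum>a\<le>n. ((a + i) choose (2 * i)) * ((n - a + (k - i)) choose (2 * (k - i)))) =
      catalan i * catalan (k - i) * ((n + k + 1) choose (2 * k + 1))"
      by (subst sum_shifted_choose_times_choose) auto
  qed
  also have "\<dots> = catalan (Suc k) * ((n + k + 1) choose (2 * k + 1))"
    by (simp add: sum_distrib_right[symmetric] catalan_convolution)
  finally show ?thesis by (simp add: schroeder_def algebra_simps)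
qed

lemma schroeder_closed_form:
  "real (schroeder n k) = 1 / real (k + 1) * real ((n + k) choose k) * real (n choose k)"
proof (cases "k \<le> n")
  case True
  have "((n + k) choose (2 * k)) * ((2 * k) choose k) = ((n + k) choose k) * (n choose k)"
    using choose_mult[of k "2 * k" "n + k"] True by simp
  then have "(k + 1) * schroeder n k = ((n + k) choose k) * (n choose k)"
    unfolding schroeder_def Suc_times_catalan[of k, symmetric] by (simp only: ac_simps)
  then have "real (k + 1) * real (schroeder n k) = real ((n + k) choose k) * real (n choose k)"
    by (simp only: of_nat_mult[symmetric])
  then show ?thesis by (simp add: field_simps)
qed (simp add: schroeder_eq_0)

section \<open>Generating functions solving the recursions\<close>

definition schroeder_fps :: "'a::idom \<Rightarrow> 'a fps" where
  "schroeder_fps y = Abs_fps (\<lambda>n. \<Sum>k\<le>n. of_nat (schroeder n k) * y ^ k)"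

lemma schroeder_fps_quadratic:
  "schroeder_fps y = 1 + fps_X * schroeder_fps y + fps_X * (fps_const y * schroeder_fps y ^ 2)"
proof (rule fps_ext)
  fix m
  show "schroeder_fps y $ m =
    (1 + fps_X * schroeder_fps y + fps_X * (fps_const y * schroeder_fps y ^ 2)) $ m"
  proof (cases m)
    case 0
    then show ?thesis by (simp add: schroeder_fps_def schroeder_def catalan_def)
  next
    case (Suc n)
    let ?s = "\<lambda>n k. of_nat (schroeder n k) :: 'a"
    have sq: "(schroeder_fps y ^ 2) $ n = (\<Sum>k\<le>n. (\<Sum>a\<le>n. \<Sum>i\<le>k. ?s a i * ?s (n - a) (k - i)) * y ^ k)"
    proof -
      have "(schroeder_fps y ^ 2) $ n =
          (\<Sum>a\<le>n. (\<Sum>i\<le>a. ?s a i * y ^ i) * (\<Sum>j\<le>n - a. ?s (n - a) j * y ^ j))"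
        by (simp add: power2_eq_square fps_mult_nth schroeder_fps_def atMost_atLeast0)
      also have "\<dots> = (\<Sum>a\<le>n. \<Sum>k\<le>n. (\<Sum>i\<le>k. ?s a i * ?s (n - a) (k - i)) * y ^ k)"
      proof (rule sum.cong[OF refl])
        fix a assume "a \<in> {..n}"
        \<comment> \<open>The two polynomials have degrees \<open>a\<close> and
          \<open>n - a\<close>, so their product has degree at most \<open>n\<close>; coefficients
          beyond these degrees vanish by \<open>schroeder_eq_0\<close>.\<close>
        then have "a + (n - a) = n" by simp
        then show "(\<Sum>i\<le>a. ?s a i * y ^ i) * (\<Sum>j\<le>n - a. ?s (n - a) j * y ^ j) =
          (\<Sum>k\<le>n. (\<Sum>i\<le>k. ?s a i * ?s (n - a) (k - i)) * y ^ k)"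
          using polynomial_product[of a "?s a" "n - a" "?s (n - a)" y] by (simp add: schroeder_eq_0)
      qed
      also have "\<dots> = (\<Sum>k\<le>n. (\<Sum>a\<le>n. \<Sum>i\<le>k. ?s a i * ?s (n - a) (k - i)) * y ^ k)"
        by (subst sum.swap) (simp add: sum_distrib_right)
      finally show ?thesis .
    qed
    have "schroeder_fps y $ Suc n = ?s (Suc n) 0 + (\<Sum>k\<le>n. ?s (Suc n) (Suc k) * y ^ Suc k)"
      by (simp add: schroeder_fps_def sum.atMost_Suc_shift del: sum.atMost_Suc)
    also have "\<dots> = ?s n 0 + (\<Sum>k\<le>n. ?s n (Suc k) * y ^ Suc k) + y * (schroeder_fps y ^ 2) $ n"
      by (simp add: schroeder_convolution sq sum.distrib sum_distrib_left algebra_simps)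
        (simp add: schroeder_def)
    also have "?s n 0 + (\<Sum>k\<le>n. ?s n (Suc k) * y ^ Suc k) = (\<Sum>k\<le>Suc n. ?s n k * y ^ k)"
      by (simp add: sum.atMost_Suc_shift del: sum.atMost_Suc)
    also have "\<dots> = schroeder_fps y $ n"
      by (simp add: schroeder_fps_def schroeder_eq_0)
    finally show ?thesis by (simp add: Suc)
  qed
qed

text \<open>The divided difference \<open>(y C(y) - z C(z)) / (y - z)\<close> written without
  division, so that the coefficient at \<open>y ^ i * z ^ (k - i)\<close> can be read off.\<close>

definition schroeder_fps2 :: "'a::idom \<Rightarrow> 'a \<Rightarrow> 'a fps" where
  "schroeder_fps2 y z =
    Abs_fps (\<lambda>n. \<Sum>k\<le>n. of_nat (schroeder n k) * (\<Sum>i\<le>k. y ^ i * z ^ (k - i)))"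

lemma diff_times_schroeder_fps2:
  "(fps_const y - fps_const z) * schroeder_fps2 y z =
    fps_const y * schroeder_fps y - fps_const z * schroeder_fps z"
proof (rule fps_ext)
  fix n
  have "(y - z) * (\<Sum>i\<le>k. y ^ i * z ^ (k - i)) = y ^ Suc k - z ^ Suc k" for k
    using diff_power_eq_sum[of y k z] by (simp add: lessThan_Suc_atMost)
  then have "(\<Sum>k\<le>n. of_nat (schroeder n k) * (y ^ Suc k - z ^ Suc k)) =
      (\<Sum>k\<le>n. of_nat (schroeder n k) * ((y - z) * (\<Sum>i\<le>k. y ^ i * z ^ (k - i))))"
    by simp
  also have "\<dots> = (y - z) * schroeder_fps2 y z $ n"
    unfolding schroeder_fps2_def fps_nth_Abs_fps
    by (subst sum_distrib_left) (simp only: mult.left_commute)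
  finally have "(y - z) * schroeder_fps2 y z $ n =
      (\<Sum>k\<le>n. of_nat (schroeder n k) * (y ^ Suc k - z ^ Suc k))" ..
  then show "((fps_const y - fps_const z) * schroeder_fps2 y z) $ n =
    (fps_const y * schroeder_fps y - fps_const z * schroeder_fps z) $ n"
    by (simp add: schroeder_fps_def sum_distrib_left sum_subtractf algebra_simps
        fps_const_sub[symmetric] del: fps_const_sub)
qed

lemma schroeder_fps2_commute:
  assumes "y \<noteq> z"
  shows "schroeder_fps2 z y = schroeder_fps2 y z"
proof -
  have "(fps_const y - fps_const z) * schroeder_fps2 z y = (fps_const y - fps_const z) * schroeder_fps2 y z"
    using diff_times_schroeder_fps2[of y z] diff_times_schroeder_fps2[of z y] by algebra
  then show ?thesis using assms by simp
qed

text \<open>With \<open>Y = y C(y)\<close> and \<open>Z = z C(z)\<close>, subtracting the quadratic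
  equations gives \<open>Y - Z = (y - z) + x (Y - Z) (1 + Y + Z)\<close>; then \<open>y - z\<close>
  is cancelled.\<close>

lemma schroeder_fps2_eq:
  assumes "y \<noteq> z"
  shows "schroeder_fps2 y z = 1 + fps_X * (schroeder_fps2 y z *
    (1 + fps_const y * schroeder_fps y + fps_const z * schroeder_fps z))"
proof -
  have "(fps_const y - fps_const z) * schroeder_fps2 y z = (fps_const y - fps_const z) *
    (1 + fps_X * (schroeder_fps2 y z * (1 + fps_const y * schroeder_fps y + fps_const z * schroeder_fps z)))"
    using diff_times_schroeder_fps2[of y z] schroeder_fps_quadratic[of y] schroeder_fps_quadratic[of z]
    by algebra
  then show ?thesis using assms by simp
qed

lemma times_schroeder_fps:
  fixes y :: "'a::idom"
  defines "Y \<equiv> fps_const y * schroeder_fps y"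
  shows "Y = fps_const y + fps_X * (Y + Y * Y)"
  unfolding Y_def using schroeder_fps_quadratic[of y] by algebra

text \<open>\<open>tail_fps y z q\<close> counts by the number of remaining points the faces with \<open>q\<close> open tails;
  for \<open>head_fps y z q\<close> there is in addition a head that has to be used, placed between the open tails
  and the remaining points. For \<open>q = 0\<close> this head is the head of backward arrows, so that the
  roles of \<open>y\<close> and \<open>z\<close> are exchanged.\<close>

definition tail_fps :: "'a::idom \<Rightarrow> 'a \<Rightarrow> nat \<Rightarrow> 'a fps" where
  "tail_fps y z q = (if q = 0 then 1 else 0) +
     (fps_X * schroeder_fps2 y z) * (fps_const y * schroeder_fps y) ^ q"

definition head_fps :: "'a::idom \<Rightarrow> 'a \<Rightarrow> nat \<Rightarrow> 'a fps" where
  "head_fps y z q = (case q of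
     0 \<Rightarrow> fps_X * schroeder_fps2 y z * (fps_const z * schroeder_fps z)
   | Suc r \<Rightarrow> fps_const y * schroeder_fps2 y z * (fps_const y * schroeder_fps y) ^ r)"

text \<open>Without open tails the required head turns, after reversing all arrows, into a single
  open tail.\<close>

lemma head_fps_0: "y \<noteq> z \<Longrightarrow> head_fps y z 0 = tail_fps z y 1"
  by (simp add: head_fps_def tail_fps_def schroeder_fps2_commute)

text \<open>The analogue of \<open>sum_weight_head_step\<close>. One open tail calls for the
  equation of \<open>schroeder_fps2\<close>; with more, the quadratic equation for
  \<open>y C(y)\<close> suffices.\<close>

lemma head_fps_Suc:
  fixes y z :: "'a::idom"
  assumes "y \<noteq> z"
  shows "head_fps y z (Suc q) =
    fps_const y * (tail_fps y z (Suc q) + (head_fps y z q + tail_fps y z q))"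
proof (cases q)
  case 0
  have "schroeder_fps2 y z = tail_fps y z 1 + (head_fps y z 0 + tail_fps y z 0)"
    by (subst schroeder_fps2_eq[OF assms]) (simp add: tail_fps_def head_fps_def algebra_simps)
  then show ?thesis using 0 by (simp add: head_fps_def)
next
  case (Suc r)
  \<comment> \<open>The series become variables, with \<open>P\<close> for the remaining power, so
    that only a polynomial identity is left.\<close>
  have *: "c * S * (Y * P) = c * (x * S * (Y * (Y * P)) + (c * S * P + x * S * (Y * P)))"
    if "Y = c + x * (Y + Y * Y)" for c S Y P x :: "'a fps"
    using that by algebra
  show ?thesis
    using *[OF times_schroeder_fps[of y]] by (simp add: Suc tail_fps_def head_fps_def)
qed

text \<open>The analogue of \<open>sum_weight_min_step\<close>; the constant 1 for
  \<open>q = 0\<close> is the empty face on no points.\<close>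

lemma tail_fps_rec:
  fixes y z :: "'a::idom"
  assumes "y \<noteq> z"
  shows "tail_fps y z q = (if q = 0 then 1 else 0) +
    fps_X * (tail_fps y z q + (tail_fps y z (Suc q) + head_fps y z q))"
proof (cases q)
  case 0
  have "1 + x * S = 1 + x * (1 + x * S + (x * S * Y + x * S * Z))"
    if "S = 1 + x * (S * (1 + Y + Z))" for S Y Z x :: "'a fps"
    using that by algebra
  from this[OF schroeder_fps2_eq[OF assms]] show ?thesis
    by (simp add: 0 tail_fps_def head_fps_def)
next
  case (Suc r)
  have *: "x * S * (Y * P) = x * (x * S * (Y * P) + (x * S * (Y * (Y * P)) + c * S * P))"
    if "Y = c + x * (Y + Y * Y)" for c S Y P x :: "'a fps"
    using that by algebra
  show ?thesis
    using *[OF times_schroeder_fps[of y]] by (simp add: Suc tail_fps_def head_fps_def)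
qed

lemma tail_fps_nth_0: "tail_fps y z q $ 0 = (if q = 0 then 1 else 0)"
  by (simp add: tail_fps_def fps_mult_nth_0)

lemma tail_fps_nth_Suc:
  assumes "y \<noteq> z"
  shows "tail_fps y z q $ Suc n = tail_fps y z q $ n + (tail_fps y z (Suc q) $ n + head_fps y z q $ n)"
  using arg_cong[OF tail_fps_rec[OF assms, of q], of "\<lambda>f. f $ Suc n"] by (cases q) simp_all

section \<open>Counting cliques\<close>

text \<open>Induction on the number of remaining points. \<open>E\<close>, \<open>y\<close> and
  \<open>z\<close> vary because reversal replaces the relation and exchanges the weights. Only the
  number of open tails enters, so the choice of nesting or crossing leaves no trace.\<close>

lemma sum_weight_faces:
  fixes Q M :: "'m::{finite,linorder} set" and y z :: "'a::idom"
  assumes "lex_adj E nf nb" "\<forall>q\<in>Q. \<forall>m\<in>M. q < m" "y \<noteq> z"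
  shows "sum (weight y z) (faces E (Q \<union> M) M Q {}) = tail_fps y z (card Q) $ card M"
  using assms
proof (induction "card M" arbitrary: E nf nb Q M y z)
  case 0
  then have "M = {}" by simp
  then have "faces E (Q \<union> M) M Q {} = (if Q = {} then {{}} else {})"
    by (auto simp: faces_def)
  then show ?case using \<open>M = {}\<close> by (simp add: tail_fps_nth_0 weight_def)
next
  case (Suc n)
  define p where "p = Min M"
  define N where "N = M - {p}"
  have "M \<noteq> {}" using Suc.hyps by auto
  then have "p \<in> M" by (simp add: p_def)
  then have M: "M = insert p N" "p \<notin> N" "\<forall>m\<in>N. p < m"
    using Min_le[of M] by (auto simp: p_def N_def less_le)
  then have N: "n = card N" using Suc.hyps by simp
  note IH = Suc.hyps(1)[OF N]
  \<comment> \<open>An inner induction on the number of open tails: removing the forced arrow may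
    keep the same remaining points and the required head \<open>p\<close>.\<close>
  have head: "sum (weight y z) (faces E (R \<union> N) (insert p N) R {p}) = head_fps y z (card R) $ n"
    if "\<forall>q\<in>R. q < p" for R
    using that
  proof (induction "card R" arbitrary: R)
    case 0
    then have "R = {}" by simp
    \<comment> \<open>All arrows into \<open>p\<close> are now backward; reversed, they make
      \<open>p\<close> the only open tail.\<close>
    have "sum (weight y z) (faces E N (insert p N) {} {p}) =
        sum (weight z y) (faces (reverse_adj E) (insert p N) N {p} {})"
      by (rule sum_weight_reverse[symmetric])
    also have "\<dots> = tail_fps z y 1 $ n"
      using IH[OF lex_adj_reverse[OF Suc.prems(1)], of "{p}" z y] M Suc.prems(3) N by auto
    finally show ?case using \<open>R = {}\<close> head_fps_0[OF Suc.prems(3)] by simp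
  next
    case (Suc r)
    define t where "t = (if nf then Max R else Min R)"
    have "R \<noteq> {}" using Suc.hyps by auto
    then have t: "t \<in> R" "\<forall>q\<in>R. if nf then q \<le> t else t \<le> q"
      using Max_in[of R] Min_in[of R] by (auto simp: t_def)
    have r: "card (R - {t}) = r" using t Suc.hyps by simp
    have lt: "\<forall>q\<in>R. \<forall>m\<in>N. q < m" using Suc.prems M by (meson order.strict_trans)
    show ?case
      unfolding sum_weight_head_step[OF \<open>lex_adj E nf nb\<close> Suc.prems M(3) t]
      using IH[OF \<open>lex_adj E nf nb\<close> lt \<open>y \<noteq> z\<close>] IH[OF \<open>lex_adj E nf nb\<close> _ \<open>y \<noteq> z\<close>, of "R - {t}"]
        Suc.hyps(1)[of "R - {t}"] Suc.prems lt r N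
      by (simp add: Suc.hyps(2)[symmetric] head_fps_Suc[OF \<open>y \<noteq> z\<close>])
  qed
  have Qp: "\<forall>q\<in>Q. q < p" using Suc.prems M by auto
  have "p \<notin> Q" using Qp by auto
  have lt: "\<forall>q\<in>insert p Q. \<forall>m\<in>N. q < m" using Suc.prems M by auto
  show ?case
    unfolding M(1) sum_weight_min_step[OF Suc.prems(1) Qp M(3)] head[OF Qp]
    using IH[OF Suc.prems(1) _ Suc.prems(3), of Q] IH[OF Suc.prems(1) lt Suc.prems(3)] M(2) N
      \<open>p \<notin> Q\<close> lt
    by (simp add: tail_fps_nth_Suc[OF Suc.prems(3)])
qed

lemma sum_weight_cliques:
  fixes E :: "'m::{finite,linorder} arrow \<Rightarrow> 'm arrow \<Rightarrow> bool" and y z :: "'a::idom"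
  assumes "lex_adj E nf nb" "y \<noteq> z" "CARD('m) = n + 1"
  shows "sum (weight y z) {\<sigma>. \<forall>a\<in>\<sigma>. \<forall>b\<in>\<sigma>. E a b} =
    (\<Sum>k\<le>n. of_nat (schroeder n k) * (\<Sum>i\<le>k. y ^ i * z ^ (k - i)))"
  \<comment> \<open>The factor \<open>fps_X\<close> in \<open>tail_fps\<close> turns the coefficient
    for \<open>n + 1\<close> points into the coefficient of \<open>schroeder_fps2\<close> at
    \<open>n\<close>.\<close>
  using sum_weight_faces[OF assms(1), of "{}" UNIV, OF _ assms(2)] assms(3)
  by (simp add: faces_def tail_fps_def schroeder_fps2_def)

lemma card_cliques:
  fixes E :: "'m::{finite,linorder} arrow \<Rightarrow> 'm arrow \<Rightarrow> bool"
  assumes "lex_adj E nf nb" "CARD('m) = n + 1"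
  shows "card {\<sigma>. (\<forall>a\<in>\<sigma>. \<forall>b\<in>\<sigma>. E a b) \<and>
    card {a\<in>\<sigma>. forward a} = i \<and> card {a\<in>\<sigma>. backward a} = j} = schroeder n (i + j)"
proof -
  \<comment> \<open>\<open>y\<close> is the outer and \<open>z\<close> the inner indeterminate of a
    polynomial ring in two variables, so a double coefficient isolates the two face numbers.\<close>
  define y z :: "int poly poly" where "y = monom 1 1" and "z = monom (monom 1 1) 0"
  have yz: "y ^ p * z ^ q = monom (monom 1 q) p" for p q
    by (simp add: y_def z_def monom_power mult_monom)
  have coeff: "coeff (coeff (y ^ p * z ^ q) i) j = (if p = i \<and> q = j then 1 else 0)" for p q
    by (simp add: yz)
  have "coeff y 1 \<noteq> coeff z 1" by (simp add: y_def z_def)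
  then have "y \<noteq> z" by auto
  let ?C = "{\<sigma>. \<forall>a\<in>\<sigma>. \<forall>b\<in>\<sigma>. E a b}"
  have "coeff (coeff (sum (weight y z) ?C) i) j =
      (\<Sum>\<sigma>\<in>?C. if card {a\<in>\<sigma>. forward a} = i \<and> card {a\<in>\<sigma>. backward a} = j then 1 else 0)"
    by (simp add: weight_def coeff_sum coeff)
  also have "\<dots> = int (card {\<sigma>. (\<forall>a\<in>\<sigma>. \<forall>b\<in>\<sigma>. E a b) \<and>
      card {a\<in>\<sigma>. forward a} = i \<and> card {a\<in>\<sigma>. backward a} = j})"
    by (simp add: sum.If_cases Int_def)
  finally have "int (card {\<sigma>. (\<forall>a\<in>\<sigma>. \<forall>b\<in>\<sigma>. E a b) \<and>
      card {a\<in>\<sigma>. forward a} = i \<and> card {a\<in>\<sigma>. backward a} = j}) =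
    coeff (coeff (\<Sum>k\<le>n. of_nat (schroeder n k) * (\<Sum>l\<le>k. y ^ l * z ^ (k - l))) i) j"
    using sum_weight_cliques[OF assms(1) \<open>y \<noteq> z\<close> assms(2)] by simp
  also have "\<dots> = (\<Sum>k\<le>n. int (schroeder n k) * (\<Sum>l\<le>k. if l = i \<and> k - l = j then 1 else 0))"
    by (simp add: coeff_sum coeff of_nat_poly)
  also have "\<dots> = (\<Sum>k\<le>n. if k = i + j then int (schroeder n k) else 0)"
  proof (rule sum.cong[OF refl])
    fix k
    have "(\<Sum>l\<le>k. if l = i \<and> k - l = j then 1 else 0 :: int) =
        (\<Sum>l\<le>k. if l = i then (if k = i + j then 1 else 0) else 0)"
      by (rule sum.cong) auto
    then show "int (schroeder n k) * (\<Sum>l\<le>k. if l = i \<and> k - l = j then 1 else 0) =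
      (if k = i + j then int (schroeder n k) else 0)" by auto
  qed
  also have "\<dots> = int (schroeder n (i + j))" by (simp add: schroeder_eq_0)
  finally show ?thesis by simp
qed

section \<open>Faces of the triangulation\<close>

lemma endpoints_eq:
  assumes "p1 < p2" "p2 < p3" "p3 < p4" "ends a \<union> ends b = {p1, p2, p3, p4}"
  shows "endpoints a b = [p1, p2, p3, p4]"
proof -
  have "sorted_list_of_set (set [p1, p2, p3, p4]) = [p1, p2, p3, p4]"
    by (rule sorted_list_of_set.idem_if_sorted_distinct) (use assms in auto)
  then show ?thesis using assms(4) by (simp add: endpoints_def)
qed

text \<open>The order of \<open>i\<close> and \<open>j\<close> decides which condition applies: the
  first pair nests with type \<open>THTH\<close> if \<open>i < j\<close> and crosses with type
  \<open>THHT\<close> if \<open>j < i\<close>. The second pair is its reversal.\<close>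

lemma lex_class_not_edge:
  assumes lex: "lex_class \<Delta>" and less: "t < p" "p < i" "p < j" and neq: "i \<noteq> j"
  shows "{(t, j), (i, p)} \<notin> \<Delta>" and "{(j, t), (p, i)} \<notin> \<Delta>"
proof -
  have arr: "(t, j) \<in> arrows" "(i, p) \<in> arrows" "(j, t) \<in> arrows" "(p, i) \<in> arrows"
    using less by (auto simp: arrows_def)
  have "{(t, j), (i, p)} \<notin> \<Delta> \<and> {(j, t), (p, i)} \<notin> \<Delta>"
  proof (cases "i < j")
    case True
    have e: "endpoints (t, j) (i, p) = [t, p, i, j]" "endpoints (j, t) (p, i) = [t, p, i, j]"
      using less True by (auto intro!: endpoints_eq simp: ends_def)
    have "pair_type (t, j) (i, p) = [T, H, T, H]" "pair_type (j, t) (p, i) = [H, T, H, T]"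
      using less True by (auto simp: pair_type_def e)
    moreover have "nests (t, j) (i, p)" "nests (j, t) (p, i)"
      by (auto simp: nests_def e ends_def insert_commute)
    ultimately show ?thesis
      using lex arr unfolding lex_class_def does_not_nest_def by blast
  next
    case False
    then have "j < i" using neq by auto
    have e: "endpoints (t, j) (i, p) = [t, p, j, i]" "endpoints (j, t) (p, i) = [t, p, j, i]"
      using less \<open>j < i\<close> by (auto intro!: endpoints_eq simp: ends_def)
    have "pair_type (t, j) (i, p) = [T, H, H, T]" "pair_type (j, t) (p, i) = [H, T, T, H]"
      using less \<open>j < i\<close> by (auto simp: pair_type_def e)
    moreover have "crosses (t, j) (i, p)" "crosses (j, t) (p, i)"
      by (auto simp: crosses_def e ends_def insert_commute)
    ultimately show ?thesis
      using lex arr unfolding lex_class_def does_not_cross_def by blast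
  qed
  then show "{(t, j), (i, p)} \<notin> \<Delta>" and "{(j, t), (p, i)} \<notin> \<Delta>" by auto
qed

lemma uniform_four_points:
  assumes "uniform \<Delta>" "i < k" "k < p" "p < h" "i' < k'" "k' < p'" "p' < h'"
  shows "{(i, h), (k, p)} \<in> \<Delta> \<longleftrightarrow> {(i', h'), (k', p')} \<in> \<Delta>"
    and "{(h, i), (p, k)} \<in> \<Delta> \<longleftrightarrow> {(h', i'), (p', k')} \<in> \<Delta>"
proof -
  have less: "i < p" "i < h" "k < h" "i' < p'" "i' < h'" "k' < h'"
    using assms by auto
  have "same_pattern [i, k, h, p] [i', k', h', p']" "same_pattern [h, p, i, k] [h', p', i', k']"
    using assms(2-) less
    by (auto simp: same_pattern_def less_Suc_eq numeral_eq_Suc)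
  moreover have "(i, h) \<in> arrows" "(k, p) \<in> arrows" "(i', h') \<in> arrows" "(k', p') \<in> arrows"
      "(h, i) \<in> arrows" "(p, k) \<in> arrows" "(h', i') \<in> arrows" "(p', k') \<in> arrows"
    using assms less by (auto simp: arrows_def)
  ultimately show "{(i, h), (k, p)} \<in> \<Delta> \<longleftrightarrow> {(i', h'), (k', p')} \<in> \<Delta>"
    and "{(h, i), (p, k)} \<in> \<Delta> \<longleftrightarrow> {(h', i'), (p', k')} \<in> \<Delta>"
    using assms(1) unfolding uniform_def by (metis fst_conv snd_conv)+
qed

text \<open>Stated for an abstract relation so as to serve both adjacency and its reversal. The flag
  asks for some joined nesting pair; by uniformity one such pair decides all.\<close>

lemma lex_half_intro:
  fixes E :: "'m::linorder arrow \<Rightarrow> 'm arrow \<Rightarrow> bool"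
  assumes head_tail: "\<And>a b. E a b \<Longrightarrow> head b \<noteq> tail a"
    and dichotomy: "\<And>i k j l. i \<noteq> k \<Longrightarrow> j \<noteq> l \<Longrightarrow> {i, k} \<inter> {j, l} = {} \<Longrightarrow>
      E (i, j) (k, l) \<longleftrightarrow> \<not> E (i, l) (k, j)"
    and lex: "\<And>t p i j. t < p \<Longrightarrow> p < i \<Longrightarrow> p < j \<Longrightarrow> i \<noteq> j \<Longrightarrow> \<not> E (t, j) (i, p)"
    and uniform: "\<And>i k p h i' k' p' h'. i < k \<Longrightarrow> k < p \<Longrightarrow> p < h \<Longrightarrow>
      i' < k' \<Longrightarrow> k' < p' \<Longrightarrow> p' < h' \<Longrightarrow> E (i, h) (k, p) \<Longrightarrow> E (i', h') (k', p')"
    and sym: "\<And>a b. E a b \<Longrightarrow> E b a"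
  shows "lex_half E (\<exists>i k p h. i < k \<and> k < p \<and> p < h \<and> E (i, h) (k, p))"
  unfolding lex_half_def
proof (intro conjI allI impI; (elim conjE)?)
  fix t p i j :: 'm assume a: "t < p" "p < i" "p < j" "i \<noteq> j"
  then have "t < i" "t < j" by auto
  \<comment> \<open>The lex class rules out the other diagonal, so this one is an edge.\<close>
  with a show "E (t, p) (i, j)" using dichotomy[of t i p j] lex[of t p i j] by auto
next
  fix t p h s :: 'm assume a: "t < p" "p < h" "p < s"
  show "\<not> E (t, h) (s, p)"
  proof (cases "s = h")
    case True
    then show ?thesis using head_tail[OF sym, of "(t, h)" "(s, p)"] by auto
  next
    case False
    then show ?thesis by (rule lex[OF a(1,3,2)])
  qed
next
  fix i k p h :: 'm assume a: "i < k" "k < p" "p < h"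
  show nest: "E (i, h) (k, p) \<longleftrightarrow> (\<exists>i k p h. i < k \<and> k < p \<and> p < h \<and> E (i, h) (k, p))"
  proof
    assume "\<exists>i k p h. i < k \<and> k < p \<and> p < h \<and> E (i, h) (k, p)"
    then show "E (i, h) (k, p)" using uniform[OF _ _ _ a] by metis
  qed (use a in metis)
  have "i \<noteq> k" "p \<noteq> h" "{i, k} \<inter> {p, h} = {}" using a by auto
  then show "E (i, p) (k, h) \<longleftrightarrow> \<not> (\<exists>i k p h. i < k \<and> k < p \<and> p < h \<and> E (i, h) (k, p))"
    unfolding nest[symmetric] by (rule dichotomy)
qed

lemma triangulation_dichotomy:
  fixes \<Delta> :: "'m::{finite,linorder} arrow set set"
  assumes \<Delta>: "uniform_flag_triangulation \<Delta>"
    and "i \<noteq> k" "j \<noteq> l" "{i, k} \<inter> {j, l} = {}"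
  shows "{(i, j), (k, l)} \<in> \<Delta> \<longleftrightarrow> {(i, l), (k, j)} \<notin> \<Delta>"
  using triangulation_diagonal[OF \<Delta> assms(4)] triangulation_not_both_diagonals[OF \<Delta> assms(4,2,3)]
  by blast

lemma triangulation_lex_adj:
  fixes \<Delta> :: "'m::{finite,linorder} arrow set set"
  assumes \<Delta>: "uniform_flag_triangulation \<Delta>" and lex: "lex_class \<Delta>"
  shows "\<exists>nf nb. lex_adj (\<lambda>a b. {a, b} \<in> \<Delta>) nf nb"
proof -
  let ?E = "\<lambda>a b. {a, b} \<in> \<Delta>"
  have uni: "uniform \<Delta>" using \<Delta> by (simp add: uniform_flag_triangulation_def)
  have sym: "?E b a" if "?E a b" for a b using that by (simp add: insert_commute)
  have head_tail: "?E a b \<Longrightarrow> head a \<noteq> tail b" for a b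
    by (rule triangulation_head_neq_tail[OF \<Delta>])
  have share: "?E a b" if "a \<in> arrows" "b \<in> arrows" "tail a = tail b \<or> head a = head b" for a b
  proof -
    obtain i j k l where ab: "a = (i, j)" "b = (k, l)" by (metis surj_pair)
    have "{i, k} \<inter> {j, l} = {}" using that ab by (auto simp: arrows_def)
    \<comment> \<open>For arrows with a common tail or head the two diagonals are the same
      pair.\<close>
    from triangulation_diagonal[OF \<Delta> this] that(3) show ?thesis
      by (auto simp: ab insert_commute)
  qed
  have "lex_half ?E (\<exists>i k p h. i < k \<and> k < p \<and> p < h \<and> ?E (i, h) (k, p))"
  proof (rule lex_half_intro)
    show "?E (i, j) (k, l) \<longleftrightarrow> \<not> ?E (i, l) (k, j)"
      if "i \<noteq> k" "j \<noteq> l" "{i, k} \<inter> {j, l} = {}" for i k j l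
      by (rule triangulation_dichotomy[OF \<Delta> that])
    show "\<not> ?E (t, j) (i, p)" if "t < p" "p < i" "p < j" "i \<noteq> j" for t p i j
      by (rule lex_class_not_edge(1)[OF lex that])
    show "?E (i', h') (k', p')"
      if "i < k" "k < p" "p < h" "i' < k'" "k' < p'" "p' < h'" "?E (i, h) (k, p)" for i k p h i' k' p' h'
      using uniform_four_points(1)[OF uni that(1-6)] that(7) by simp
    show "head b \<noteq> tail a" if "?E a b" for a b by (rule head_tail[OF sym[OF that]])
  qed (rule sym)
  moreover have "lex_half (reverse_adj ?E)
    (\<exists>i k p h. i < k \<and> k < p \<and> p < h \<and> reverse_adj ?E (i, h) (k, p))"
  proof (rule lex_half_intro)
    show "reverse_adj ?E (i, j) (k, l) \<longleftrightarrow> \<not> reverse_adj ?E (i, l) (k, j)"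
      if "i \<noteq> k" "j \<noteq> l" "{i, k} \<inter> {j, l} = {}" for i k j l
    proof -
      have "{j, l} \<inter> {i, k} = {}" using that(3) by blast
      from triangulation_dichotomy[OF \<Delta> that(2,1) this] show ?thesis
        by (simp add: reverse_adj_def insert_commute)
    qed
    show "\<not> reverse_adj ?E (t, j) (i, p)" if "t < p" "p < i" "p < j" "i \<noteq> j" for t p i j
      using lex_class_not_edge(2)[OF lex that] by (simp add: reverse_adj_def)
    show "reverse_adj ?E (i', h') (k', p')"
      if "i < k" "k < p" "p < h" "i' < k'" "k' < p'" "p' < h'" "reverse_adj ?E (i, h) (k, p)"
      for i k p h i' k' p' h'
      using uniform_four_points(2)[OF uni that(1-6)] that(7) by (simp add: reverse_adj_def)
    show "head b \<noteq> tail a" if "reverse_adj ?E a b" for a b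
      using head_tail[of "prod.swap a" "prod.swap b"] that by (simp add: reverse_adj_def)
    show "reverse_adj ?E b a" if "reverse_adj ?E a b" for a b
      using that by (simp add: reverse_adj_def insert_commute)
  qed
  ultimately have "lex_adj ?E (\<exists>i k p h. i < k \<and> k < p \<and> p < h \<and> ?E (i, h) (k, p))
      (\<exists>i k p h. i < k \<and> k < p \<and> p < h \<and> reverse_adj ?E (i, h) (k, p))"
    unfolding lex_adj_def using sym head_tail share by blast
  then show ?thesis by blast
qed

section \<open>Faces as cliques and the face numbers\<close>

lemma triangulation_eq_cliques:
  fixes \<Delta> :: "'m::{finite,linorder} arrow set set"
  assumes \<Delta>: "uniform_flag_triangulation \<Delta>"
  shows "\<sigma> \<in> \<Delta> \<longleftrightarrow> (\<forall>a\<in>\<sigma>. \<forall>b\<in>\<sigma>. {a, b} \<in> \<Delta>)"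
proof
  assume "\<sigma> \<in> \<Delta>"
  then show "\<forall>a\<in>\<sigma>. \<forall>b\<in>\<sigma>. {a, b} \<in> \<Delta>"
    by (auto intro!: triangulation_subset_closed[OF \<Delta> \<open>\<sigma> \<in> \<Delta>\<close>])
next
  assume e: "\<forall>a\<in>\<sigma>. \<forall>b\<in>\<sigma>. {a, b} \<in> \<Delta>"
  \<comment> \<open>Taking \<open>b = a\<close> shows that each singleton is a face, hence consists
    of an arrow.\<close>
  then have "\<sigma> \<subseteq> arrows" using triangulation_subset_arrows[OF \<Delta>] by blast
  moreover have "\<forall>\<sigma>. \<sigma> \<subseteq> arrows \<and> (\<forall>u\<in>\<sigma>. \<forall>v\<in>\<sigma>. {u, v} \<in> \<Delta>) \<longrightarrow> \<sigma> \<in> \<Delta>"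
    using \<Delta> unfolding uniform_flag_triangulation_def flag_complex_def by (elim conjE)
  ultimately show "\<sigma> \<in> \<Delta>" using e by blast
qed

lemma face_count_eq_sum_fb_face_count:
  fixes \<Delta> :: "'m::{finite,linorder} arrow set set"
  assumes "\<And>\<sigma>. \<sigma> \<in> \<Delta> \<Longrightarrow> \<sigma> \<subseteq> arrows"
  shows "face_count \<Delta> (int k - 1) = (\<Sum>i\<le>k. fb_face_count \<Delta> i (k - i))"
proof -
  have card: "card \<sigma> = card {a\<in>\<sigma>. forward a} + card {a\<in>\<sigma>. backward a}" if "\<sigma> \<in> \<Delta>" for \<sigma>
  proof -
    have "\<sigma> = {a\<in>\<sigma>. forward a} \<union> {a\<in>\<sigma>. backward a}"
      using assms[OF that] by (auto simp: forward_def backward_def arrows_def)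
    then have "card \<sigma> = card ({a\<in>\<sigma>. forward a} \<union> {a\<in>\<sigma>. backward a})" by simp
    also have "\<dots> = card {a\<in>\<sigma>. forward a} + card {a\<in>\<sigma>. backward a}"
      by (rule card_Un_disjoint) (auto simp: forward_def backward_def)
    finally show ?thesis .
  qed
  have "{\<sigma>\<in>\<Delta>. int (card \<sigma>) - 1 = int k - 1} =
    (\<Union>i\<le>k. {\<sigma>\<in>\<Delta>. card {a\<in>\<sigma>. forward a} = i \<and> card {a\<in>\<sigma>. backward a} = k - i})" (is "?A = ?B")
  proof (rule set_eqI)
    fix \<sigma> show "\<sigma> \<in> ?A \<longleftrightarrow> \<sigma> \<in> ?B" using card[of \<sigma>] by auto
  qed
  then show ?thesis
    unfolding face_count_def fb_face_count_def by (simp only:) (rule card_UN_disjoint; auto)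
qed

theorem theorem9p1:
  fixes \<Delta> :: "'m::{finite,linorder} arrow set set" and n i k :: nat
  assumes "CARD('m) = n + 1"
    and "uniform_flag_triangulation \<Delta>"
    and "lex_class \<Delta>"
    and "i \<le> k"
  shows "real (fb_face_count \<Delta> i (k - i)) = real (face_count \<Delta> (int k - 1)) / real (k + 1) \<and>
    real (face_count \<Delta> (int k - 1)) / real (k + 1)
      = 1 / real (k + 1) * real ((n + k) choose k) * real (n choose k)"
proof -
  obtain nf nb where E: "lex_adj (\<lambda>a b. {a, b} \<in> \<Delta>) nf nb"
    using triangulation_lex_adj[OF assms(2,3)] by blast
  have fb: "fb_face_count \<Delta> l (k - l) = schroeder n k" if "l \<le> k" for l
    using card_cliques[OF E assms(1), of l "k - l"] that
    unfolding fb_face_count_def triangulation_eq_cliques[OF assms(2), symmetric] by simp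
  \<comment> \<open>The number of forward arrows takes the \<open>k + 1\<close> values from 0 to
    \<open>k\<close>, each equally often; this is the source of the denominator.\<close>
  have "face_count \<Delta> (int k - 1) = (k + 1) * schroeder n k"
    using face_count_eq_sum_fb_face_count[of \<Delta> k] triangulation_subset_arrows[OF assms(2)]
    by (simp add: fb)
  then have "real (face_count \<Delta> (int k - 1)) / real (k + 1) = real (schroeder n k)"
    by (simp add: field_simps)
  then show ?thesis using fb[OF assms(4)] schroeder_closed_form[of n k] by simp
qed

end
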